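(* Let $\alpha := 2^{-5/2}\, 3^{1/2}\, \pi$. Let $k\ge 1$ and $m\ge 2$ be integers, and let $f\in C(T)$. Then $$ \|f-v_{k,m}f\| \le \frac{2(k+1)^2}{\binom{2k}{k}}\ \omega_{2k}\Bigl(f,\frac{2\pi}{km}\,\alpha\Bigr). $$
   Context: $T=[-\pi,\pi)$ is the circle $\mathbb{R}/2\pi\mathbb{Z}$, and $C(T)$ is the space of continuous (complex-valued, $2\pi$-periodic) functions on $T$ with norm $\|f\|:=\max_{x\in T}|f(x)|$. For an integer $i\ge0$, $s_i$ is the operator of the $i$-th partial Fourier sum, $s_if(x)=\sum_{j=-i}^{i}\hat f(j)e^{ijx}$ (in the exponent, $e^{ijx}$ denotes $\exp(\sqrt{-1}\,jx)$), where $\hat f(j)=\frac{1}{2\pi}\int_{-\pi}^{\pi}f(t)\exp(-\sqrt{-1}\,jt)\,dt$. The Vallée Poussin means are $$ v_{k,m}:=\frac1m\sum_{i=km}^{(k+1)m-1}s_i. $$ For an integer $r\ge1$ and a real step $h$, the (central) $r$-th difference is $$\Delta_h^r f(x):=\sum_{i=0}^r(-1)^{r-i}\binom{r}{i} f\bigl(x-(r/2)h+ih\bigr),$$ and the $r$-th modulus of smoothness is $\omega_r(f,\delta):=\sup_{x\in T,\ |h|<\delta}|\Delta_h^r f(x)|$ for $\delta>0$. *)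

theory Defs
  imports "HOL-Analysis.Analysis"
begin

text \<open>Functions on the circle are represented by their \<open>2 * pi\<close>-periodic lifts to the real line.\<close>

definition continuous_circle :: "(real \<Rightarrow> complex) set" where
  "continuous_circle = {f. continuous_on UNIV f \<and> (\<forall>x. f (x + 2 * pi) = f x)}"

text \<open>On \<open>continuous_circle\<close> this supremum is attained, hence it is the maximum norm.\<close>

definition circle_norm :: "(real \<Rightarrow> complex) \<Rightarrow> real" where
  "circle_norm f = (SUP x\<in>{-pi..<pi}. cmod (f x))"

definition fourier_coeff :: "(real \<Rightarrow> complex) \<Rightarrow> int \<Rightarrow> complex" where
  "fourier_coeff f j =
     1 / (2 * complex_of_real pi) *
       integral {-pi..pi} (\<lambda>t. f t * exp (- \<i> * of_int j * complex_of_real t))"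

definition fourier_partial_sum :: "nat \<Rightarrow> (real \<Rightarrow> complex) \<Rightarrow> real \<Rightarrow> complex" where
  "fourier_partial_sum n f x =
     (\<Sum>j = - int n..int n. fourier_coeff f j * exp (\<i> * of_int j * complex_of_real x))"

definition vallee_poussin_mean :: "nat \<Rightarrow> nat \<Rightarrow> (real \<Rightarrow> complex) \<Rightarrow> real \<Rightarrow> complex" where
  "vallee_poussin_mean k m f x =
     1 / of_nat m * (\<Sum>i = k * m..<(k + 1) * m. fourier_partial_sum i f x)"

definition central_difference :: "nat \<Rightarrow> real \<Rightarrow> (real \<Rightarrow> complex) \<Rightarrow> real \<Rightarrow> complex" where
  "central_difference r h f x =
     (\<Sum>i = 0..r. (- 1) ^ (r - i) * of_nat (r choose i) * f (x - (real r / 2) * h + real i * h))"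

text \<open>The supremum is taken in the reals; it is meaningful for \<open>\<delta> > 0\<close> and bounded \<open>f\<close>.\<close>

definition modulus_of_smoothness :: "nat \<Rightarrow> (real \<Rightarrow> complex) \<Rightarrow> real \<Rightarrow> real" where
  "modulus_of_smoothness r f \<delta> =
     (SUP (x, h)\<in>{-pi..<pi} \<times> {h. \<bar>h\<bar> < \<delta>}. cmod (central_difference r h f x))"

definition \<alpha>_const :: real where
  "\<alpha>_const = 2 powr (- 5 / 2) * 3 powr (1 / 2) * pi"

end

(* Since v = (k+1) sigma_{(k+1)m} - k sigma_{km} for the Fejer means sigma_p, the operator I - v has norm
   at most 2(k+1), commutes with differences, and annihilates all frequencies up to n = km.  By density
   it suffices to treat trigonometric polynomials.  Put g = f - v f and let G'' = g.  Integrating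
   (h - t) times the 2k-th difference of g with step t over [0, h], h = 2 pi alpha / n, isolates g(x), up to
   second differences of G with steps ih.  The convex sequence 1/j^2 is a positive combination of
   Fejer weights, which yields |G| <= (3/n^2) |g|; for this h the second differences contribute at most
   k/(k+1) |g|.  Absorbing that term costs the second factor k+1. *)

theory Submission
  imports Defs
begin

text \<open>In a single difference the translates of \<open>g\<close> carry total weight
  \<open>4^k - ((2 * k) choose k)\<close>, at least that of the middle term, so no fixed step
  isolates \<open>g x\<close>. Averaging over the step keeps the middle term, which does not depend
  on \<open>t\<close>, and smooths the translates. The weight \<open>h - t\<close> is chosen because
  it vanishes at \<open>t = h\<close>, while the symmetric pairs cancel the first derivatives at
  \<open>t = 0\<close>: only values of \<open>G\<close> survive, the \<open>i\<close>-th pair with a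
  factor 1/i^2. The middle term gains h^2/2, and the spectral gap makes \<open>G\<close> of size
  3/n^2, so only the product \<open>h n\<close> matters. The sum of 1/i^2 contributes pi^2/6, and
  the ratio of the two largest distinct binomials contributes k/(k+1). What remains to be checked is
  12 (pi^2/6 + 1) \<le> (h n)^2, and the given \<alpha> makes the right side 3 pi^4/8. Both averages
  are handled without integration: Fejer means are finite averages over a grid, and the average over
  the step is a mean value inequality.\<close>

section \<open>Trigonometric sums and Fejer means on an equispaced grid\<close>

text \<open>Discrete orthogonality of characters by a geometric sum: the bound on \<open>j\<close>
  excludes nonzero multiples of \<open>N\<close>, so the ratio is a root of unity other than
  1.\<close>

lemma cis_average:
  fixes j :: int and N :: nat
  assumes "\<bar>j\<bar> < int N"
  shows "(\<Sum>l<N. cis (of_int j * (2 * pi * real l / real N))) = (if j = 0 then of_nat N else 0)"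
proof (cases "j = 0")
  case False
  define z where "z = cis (2 * pi * (of_int j / real N))"
  have N: "N > 0" using assms by (cases N) auto
  have "z \<noteq> 1"
  proof
    assume "z = 1"
    then have "exp (\<i> * of_real (2 * pi * (of_int j / real N))) = 1"
      by (simp add: z_def cis_conv_exp)
    then obtain n :: int where "2 * pi * (of_int j / real N) = of_int (2 * n) * pi"
      by (auto simp: exp_eq_1)
    then have "of_int j = of_int n * real N"
      using N by (simp add: field_simps)
    then have "j = n * int N" by (metis of_int_eq_iff of_int_mult of_int_of_nat_eq)
    then show False using assms False
      by (metis abs_mult abs_of_nat dvd_imp_le_int dvd_triv_right linorder_not_less)
  qed
  moreover have "z ^ N = 1"
  proof -
    have "z ^ N = cis (real N * (2 * pi * (of_int j / real N)))"
      unfolding z_def by (rule Complex.DeMoivre)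
    also have "real N * (2 * pi * (of_int j / real N)) = 2 * pi * of_int j"
      using N by simp
    finally show ?thesis by simp
  qed
  moreover have "(\<Sum>l<N. cis (of_int j * (2 * pi * real l / real N))) = (\<Sum>l<N. z ^ l)"
    by (rule sum.cong) (auto simp: z_def Complex.DeMoivre field_simps)
  ultimately show ?thesis
    using False by (simp add: geometric_sum)
qed auto

text \<open>Explicit coefficients turn every operator in the proof (means, differences,
  antiderivatives) into a multiplier acting on \<open>c\<close> with \<open>d\<close> fixed, so all
  of them visibly commute.\<close>

definition trig_sum :: "nat \<Rightarrow> (int \<Rightarrow> complex) \<Rightarrow> real \<Rightarrow> complex" where
  "trig_sum d c x = (\<Sum>j = - int d..int d. c j * cis (of_int j * x))"

lemma trig_sum_cong:
  "(\<And>j. \<bar>j\<bar> \<le> int d \<Longrightarrow> c j = c' j) \<Longrightarrow> trig_sum d c x = trig_sum d c' x"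
  unfolding trig_sum_def by (rule sum.cong) auto

lemma trig_sum_add: "trig_sum d c x + trig_sum d c' x = trig_sum d (\<lambda>j. c j + c' j) x"
  by (simp add: trig_sum_def sum.distrib algebra_simps)

lemma trig_sum_diff: "trig_sum d c x - trig_sum d c' x = trig_sum d (\<lambda>j. c j - c' j) x"
  by (simp add: trig_sum_def sum_subtractf algebra_simps)

lemma trig_sum_cmult: "a * trig_sum d c x = trig_sum d (\<lambda>j. a * c j) x"
  by (simp add: trig_sum_def sum_distrib_left mult.assoc)

lemma trig_sum_sum:
  "(\<Sum>i\<in>I. trig_sum d (c i) x) = trig_sum d (\<lambda>j. \<Sum>i\<in>I. c i j) x"
  unfolding trig_sum_def by (subst sum.swap) (simp add: sum_distrib_right)

lemma trig_sum_shift: "trig_sum d c (x + y) = trig_sum d (\<lambda>j. c j * cis (of_int j * y)) x"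
  unfolding trig_sum_def by (rule sum.cong) (auto simp: cis_mult algebra_simps)

definition fejer_weight :: "nat \<Rightarrow> int \<Rightarrow> real" where
  "fejer_weight p j = max 0 (1 - \<bar>of_int j\<bar> / real p)"

text \<open>The squared form makes positivity immediate; that its Fourier coefficients are the Fejer
  weights is the counting in \<open>card_shifted_pairs\<close>.\<close>

definition fejer_kernel :: "nat \<Rightarrow> real \<Rightarrow> real" where
  "fejer_kernel p y = (cmod (\<Sum>a<p. cis (real a * y)))\<^sup>2 / real p"

lemma mult_fejer_weight: "p > 0 \<Longrightarrow> real p * fejer_weight p j = max 0 (real p - \<bar>of_int j\<bar>)"
  by (simp add: fejer_weight_def max_mult_distrib_left right_diff_distrib)

lemma fejer_kernel_nonneg: "0 \<le> fejer_kernel p y"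
  by (simp add: fejer_kernel_def)

text \<open>Expanding the squared modulus in the kernel gives one term for each pair
  \<open>(a, b)\<close>. Frequency \<open>j\<close> survives averaging exactly when
  \<open>b - a = j\<close>, and the admissible \<open>a\<close> form an interval of length p - |j|,
  empty when |j| \<ge> p.\<close>

lemma card_shifted_pairs:
  "(\<Sum>a<p. \<Sum>b<p. if j + int a - int b = 0 then 1 else (0::complex)) = of_real (real p * fejer_weight p j)"
proof -
  have "(\<Sum>b<p. if j + int a - int b = 0 then 1 else (0::complex)) =
      (if 0 \<le> j + int a \<and> j + int a < int p then 1 else 0)" for a
  proof -
    have "(\<Sum>b<p. if j + int a - int b = 0 then 1 else (0::complex)) =
        (\<Sum>b<p. if b = nat (j + int a) \<and> 0 \<le> j + int a then 1 else 0)"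
      by (rule sum.cong) auto
    also have "\<dots> = (if 0 \<le> j + int a \<and> j + int a < int p then 1 else 0)"
      by (cases "0 \<le> j + int a") (auto simp: sum.delta)
    finally show ?thesis .
  qed
  then have "(\<Sum>a<p. \<Sum>b<p. if j + int a - int b = 0 then 1 else (0::complex)) =
      (\<Sum>a<p. if 0 \<le> j + int a \<and> j + int a < int p then 1 else 0)"
    by simp
  also have "\<dots> = of_nat (card {a \<in> {..<p}. 0 \<le> j + int a \<and> j + int a < int p})"
    by (simp add: sum.If_cases Int_def)
  also have "{a \<in> {..<p}. 0 \<le> j + int a \<and> j + int a < int p} = {nat (- j)..<nat (int p - max 0 j)}"
    by auto
  also have "of_nat (card \<dots>) = (of_real (real p * fejer_weight p j) :: complex)"
  proof (cases "\<bar>j\<bar> < int p")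
    case True
    then have "real (card {nat (- j)..<nat (int p - max 0 j)}) = real p - \<bar>of_int j\<bar>"
      by (auto simp: of_nat_diff)
    moreover have "\<bar>real_of_int j\<bar> < real p" using True by linarith
    then have "real p * fejer_weight p j = real p - \<bar>of_int j\<bar>"
      by (auto simp: fejer_weight_def max_def field_simps)
    ultimately show ?thesis by (metis of_real_of_nat_eq)
  next
    case False
    then have "card {nat (- j)..<nat (int p - max 0 j)} = 0"
      by auto
    moreover have "\<bar>real_of_int j\<bar> \<ge> real p" using False by linarith
    then have "real p * fejer_weight p j = 0"
      by (cases "p = 0") (auto simp: fejer_weight_def max_def field_simps)
    ultimately show ?thesis by simp
  qed
  finally show ?thesis .
qed

text \<open>The product of sum and kernel has frequencies \<open>j + a - b\<close> of modulus at
  most \<open>d + p - 1\<close>. With \<open>N\<close> at least \<open>d + p\<close> there is no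
  aliasing, so the grid average equals the convolution exactly.\<close>

lemma fejer_sum_eq_average:
  assumes "p > 0" "d + p \<le> N"
  shows "trig_sum d (\<lambda>j. of_real (fejer_weight p j) * c j) x =
    (\<Sum>l<N. trig_sum d c (x + 2 * pi * real l / real N) * of_real (fejer_kernel p (2 * pi * real l / real N)))
      / of_nat N"
proof -
  define y where "y l = 2 * pi * real l / real N" for l
  have N: "N > 0" using assms by simp
  have ker: "of_real (real p * fejer_kernel p t) = (\<Sum>a<p. \<Sum>b<p. cis (real a * t) * cis (- (real b * t)))" for t
  proof -
    have "complex_of_real (real p * fejer_kernel p t) = of_real ((cmod (\<Sum>a<p. cis (real a * t)))\<^sup>2)"
      using assms by (simp add: fejer_kernel_def)
    also have "\<dots> = (\<Sum>a<p. cis (real a * t)) * cnj (\<Sum>a<p. cis (real a * t))"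
      by (rule complex_norm_square)
    finally show ?thesis by (simp add: sum_product cis_cnj)
  qed
  have "(\<Sum>l<N. trig_sum d c (x + y l) * of_real (real p * fejer_kernel p (y l)))
    = (\<Sum>l<N. \<Sum>j = - int d..int d. \<Sum>a<p. \<Sum>b<p.
        c j * cis (of_int j * x) * cis (of_int (j + int a - int b) * y l))"
    unfolding ker trig_sum_def sum_distrib_right unfolding sum_distrib_left
    by (intro sum.cong refl) (simp add: cis_mult mult.assoc algebra_simps)
  also have "\<dots> = (\<Sum>j = - int d..int d. \<Sum>a<p. \<Sum>b<p. \<Sum>l<N.
        c j * cis (of_int j * x) * cis (of_int (j + int a - int b) * y l))"
    by (subst sum.swap, rule sum.cong[OF refl], subst sum.swap, rule sum.cong[OF refl], rule sum.swap)
  also have "\<dots> = (\<Sum>j = - int d..int d. \<Sum>a<p. \<Sum>b<p.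
        c j * cis (of_int j * x) * (if j + int a - int b = 0 then of_nat N else 0))"
  proof (intro sum.cong refl)
    fix j a b assume "j \<in> {- int d..int d}" "a \<in> {..<p}" "b \<in> {..<p}"
    then have "\<bar>j + int a - int b\<bar> < int N" using assms by auto
    from cis_average[OF this] show "(\<Sum>l<N. c j * cis (of_int j * x) * cis (of_int (j + int a - int b) * y l)) =
       c j * cis (of_int j * x) * (if j + int a - int b = 0 then of_nat N else 0)"
      by (simp only: y_def sum_distrib_left[symmetric])
  qed
  also have "\<dots> = (\<Sum>j = - int d..int d. c j * cis (of_int j * x) * of_nat N *
      (\<Sum>a<p. \<Sum>b<p. if j + int a - int b = 0 then 1 else 0))"
    unfolding sum_distrib_left by (intro sum.cong refl) auto
  also have "\<dots> = of_nat N * of_nat p * trig_sum d (\<lambda>j. of_real (fejer_weight p j) * c j) x"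
    unfolding card_shifted_pairs trig_sum_def sum_distrib_left by (intro sum.cong refl) auto
  finally have "of_nat p * (\<Sum>l<N. trig_sum d c (x + y l) * of_real (fejer_kernel p (y l))) =
      of_nat N * of_nat p * trig_sum d (\<lambda>j. of_real (fejer_weight p j) * c j) x"
    by (simp add: sum_distrib_left algebra_simps)
  then show ?thesis
    using N assms by (simp add: y_def field_simps)
qed

lemma norm_fejer_sum_le:
  assumes M: "\<And>x. norm (trig_sum d c x) \<le> M" and "p > 0"
  shows "norm (trig_sum d (\<lambda>j. of_real (fejer_weight p j) * c j) x) \<le> M"
proof -
  define N where "N = d + p"
  define y where "y l = 2 * pi * real l / real N" for l
  have dN: "d + p \<le> N" by (simp add: N_def)
  have N: "N > 0" using assms by (simp add: N_def)
  \<comment> \<open>The kernel has mean 1 on the grid: this is the averaging identity for the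
    constant function 1, a sum of degree 0. Together with positivity it gives a contraction.\<close>
  have "complex_of_real ((\<Sum>l<N. fejer_kernel p (y l)) / real N) = 1"
    using fejer_sum_eq_average[of p 0 N "\<lambda>_. 1" 0] \<open>p > 0\<close>
    by (simp add: trig_sum_def N_def y_def fejer_weight_def)
  then have ker: "(\<Sum>l<N. fejer_kernel p (y l)) / real N = 1"
    by (simp only: of_real_eq_1_iff)
  have "norm (trig_sum d (\<lambda>j. of_real (fejer_weight p j) * c j) x) =
     norm (\<Sum>l<N. trig_sum d c (x + y l) * of_real (fejer_kernel p (y l))) / real N"
    using fejer_sum_eq_average[OF \<open>p > 0\<close>, of d N c x] by (simp add: dN y_def norm_divide)
  also have "\<dots> \<le> (\<Sum>l<N. M * fejer_kernel p (y l)) / real N"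
    by (intro divide_right_mono sum_norm_le)
       (auto simp: norm_mult fejer_kernel_nonneg intro!: mult_right_mono M)
  also have "\<dots> = M"
    using ker by (simp flip: sum_distrib_left)
  finally show ?thesis .
qed

lemma norm_fejer_combination_le:
  fixes w :: "'a \<Rightarrow> real"
  assumes M: "\<And>x. norm (trig_sum d c x) \<le> M" and "\<And>i. i \<in> I \<Longrightarrow> p i > 0"
  shows "norm (trig_sum d (\<lambda>j. of_real (\<Sum>i\<in>I. w i * fejer_weight (p i) j) * c j) x) \<le> (\<Sum>i\<in>I. \<bar>w i\<bar>) * M"
proof -
  have "trig_sum d (\<lambda>j. of_real (\<Sum>i\<in>I. w i * fejer_weight (p i) j) * c j) x =
      (\<Sum>i\<in>I. of_real (w i) * trig_sum d (\<lambda>j. of_real (fejer_weight (p i) j) * c j) x)"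
    by (simp add: trig_sum_cmult trig_sum_sum sum_distrib_right mult.assoc)
  also have "norm \<dots> \<le> (\<Sum>i\<in>I. \<bar>w i\<bar> * M)"
    using assms by (intro sum_norm_le) (auto simp: norm_mult intro!: mult_left_mono norm_fejer_sum_le)
  finally show ?thesis by (simp add: sum_distrib_right)
qed

section \<open>Convex multipliers and the bound for the second antiderivative\<close>

text \<open>Summation by parts twice: second differences of \<open>q\<close> are the coefficients of
  tents \<open>max 0 (p - j)\<close>. Stopping at the degree \<open>d\<close> leaves a last tent and
  a constant as boundary terms. Convexity enters later, as the sign of the coefficients.\<close>

lemma convex_sequence_as_fejer_weights:
  fixes q :: "nat \<Rightarrow> real" and j n d :: nat
  assumes "n \<le> j" "j \<le> d"
  shows "(\<Sum>p\<in>{n<..d}. (q (p - 1) - 2 * q p + q (p + 1)) * max 0 (real p - real j))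
     + (q d - q (d + 1)) * (real d - real j) + q d = q j"
  using assms(2)
proof (induction d rule: dec_induct)
  case base
  have "(\<Sum>p\<in>{n<..j}. (q (p - 1) - 2 * q p + q (p + 1)) * max 0 (real p - real j)) = 0"
    by (intro sum.neutral) auto
  then show ?case by simp
next
  case (step d)
  have "{n<..Suc d} = insert (Suc d) {n<..d}" using step assms by auto
  then show ?case using step by (simp add: algebra_simps)
qed

text \<open>The same telescoping at frequency 0, where the tent of index \<open>p\<close> has height
  \<open>p\<close>. The right side is the value at 0 of the line through the points of
  \<open>q\<close> at \<open>n\<close> and \<open>n + 1\<close>, independent of
  \<open>d\<close>.\<close>

lemma convex_sequence_total_mass:
  fixes q :: "nat \<Rightarrow> real" and n d :: nat
  assumes "n \<le> d"
  shows "(\<Sum>p\<in>{n<..d}. (q (p - 1) - 2 * q p + q (p + 1)) * real p)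
     + (q d - q (d + 1)) * real d + q d = q n + real n * (q n - q (n + 1))"
  using assms
proof (induction d rule: dec_induct)
  case (step d)
  have "{n<..Suc d} = insert (Suc d) {n<..d}" using step by auto
  then show ?case using step by (simp add: algebra_simps)
qed (auto simp: algebra_simps)

text \<open>With a = 1/(p-1) and b = 1/(p+1), the sum a + b is at least 2/p, and 2(a^2 + b^2) is at
  least (a + b)^2. At \<open>p = 1\<close> the convention 1/0 = 0 makes the expression
  negative.\<close>

lemma inverse_square_convex:
  fixes p :: nat
  assumes "p > 1"
  shows "0 \<le> 1 / (real (p - 1))\<^sup>2 - 2 * (1 / (real p)\<^sup>2) + 1 / (real (p + 1))\<^sup>2"
proof -
  define t where "t = real p"
  have t: "t > 1" using assms by (simp add: t_def)
  define a b where "a = 1 / (t - 1)" and "b = 1 / (t + 1)"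
  have "a > 0" "b > 0" using t by (auto simp: a_def b_def)
  have "a + b = 2 * t / (t\<^sup>2 - 1)" 
    using t by (simp add: a_def b_def field_simps power2_eq_square)
  moreover have "t * t > 1" using t by (simp add: less_1_mult)
  then have "2 * t / (t\<^sup>2 - 1) \<ge> 2 / t"
    using t by (simp add: field_simps power2_eq_square)
  ultimately have "a + b \<ge> 2 / t" by simp
  then have "(a + b)\<^sup>2 \<ge> (2 / t)\<^sup>2" using t by (intro power_mono) auto
  moreover have "2 * (a\<^sup>2 + b\<^sup>2) \<ge> (a + b)\<^sup>2"
    using zero_le_power2[of "a - b"] by (simp add: power2_eq_square algebra_simps)
  ultimately have "a\<^sup>2 + b\<^sup>2 \<ge> 2 * (1 / t\<^sup>2)" by (simp add: power_divide)
  then show ?thesis using assms by (simp add: a_def b_def t_def power_divide of_nat_diff add.commute)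
qed

text \<open>Only frequencies from \<open>n\<close> to \<open>d\<close> matter, so 1/j^2 may be
  continued linearly below \<open>n\<close>. Using only Fejer weights with \<open>p > n\<close> does
  exactly this, and all coefficients are then nonnegative, so the norm is at most the total
  mass.\<close>

lemma second_antiderivative_bound:
  assumes M: "\<And>x. norm (trig_sum d c x) \<le> M"
    and low: "\<And>j. \<bar>j\<bar> < int n \<Longrightarrow> c j = 0" and "n \<ge> 1"
  shows "norm (trig_sum d (\<lambda>j. c j / (of_int j)\<^sup>2) x) \<le> 3 / (real n)\<^sup>2 * M"
proof -
  have "0 \<le> M" using M[of 0] norm_ge_zero order_trans by blast
  show ?thesis
  proof (cases "d < n")
    case True
    then have "trig_sum d (\<lambda>j. c j / (of_int j)\<^sup>2) x = 0"
      unfolding trig_sum_def using low by (intro sum.neutral) auto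
    then show ?thesis using \<open>0 \<le> M\<close> by simp
  next
    case False
    then have nd: "n \<le> d" by simp
    define q where "q p = 1 / (real p)\<^sup>2" for p
    define b where "b p = q (p - 1) - 2 * q p + q (p + 1)" for p
    define W where "W j = (\<Sum>p\<in>{n<..d}. (b p * real p) * fejer_weight p j)" for j
    \<comment> \<open>\<open>V\<close> is the boundary tent at \<open>d\<close>, written as a sum
      over one index so that \<open>norm_fejer_combination_le\<close> applies to it as it does to
      \<open>W\<close>.\<close>
    define V where "V j = (\<Sum>p\<in>{d}. ((q d - q (d + 1)) * real d) * fejer_weight p j)" for j
    have mult: "1 / (of_int j)\<^sup>2 = W j + V j + q d" if "\<bar>j\<bar> \<le> int d" "\<bar>j\<bar> \<ge> int n" for j :: int
    proof -
      define i where "i = nat \<bar>j\<bar>"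
      have i: "n \<le> i" "i \<le> d" "\<bar>real_of_int j\<bar> = real i" using that by (auto simp: i_def)
      have fw: "real p * fejer_weight p j = max 0 (real p - real i)" if "p > 0" for p
        using mult_fejer_weight[OF that, of j] by (simp add: i)
      have "1 / (of_int j)\<^sup>2 = q i" by (simp add: q_def flip: i(3))
      also have "\<dots> = W j + V j + q d"
        using convex_sequence_as_fejer_weights[OF i(1,2), of q] nd \<open>n \<ge> 1\<close> i(2)
        by (simp add: W_def V_def b_def mult.assoc fw)
      finally show ?thesis .
    qed
    have "trig_sum d (\<lambda>j. c j / (of_int j)\<^sup>2) x =
        trig_sum d (\<lambda>j. of_real (W j) * c j + of_real (V j) * c j + of_real (q d) * c j) x"
    proof (rule trig_sum_cong)
      fix j assume j: "\<bar>j\<bar> \<le> int d"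
      show "c j / (of_int j)\<^sup>2 = of_real (W j) * c j + of_real (V j) * c j + of_real (q d) * c j"
      proof (cases "\<bar>j\<bar> < int n")
        case False
        then have "complex_of_real (1 / (of_int j)\<^sup>2) = of_real (W j + V j + q d)"
          using mult j by simp
        moreover have "c j / (of_int j)\<^sup>2 = complex_of_real (1 / (of_int j)\<^sup>2) * c j"
          by simp
        ultimately show ?thesis by (simp only: of_real_add distrib_right)
      qed (simp add: low)
    qed
    also have "\<dots> = trig_sum d (\<lambda>j. of_real (W j) * c j) x + trig_sum d (\<lambda>j. of_real (V j) * c j) x
        + of_real (q d) * trig_sum d c x"
      by (simp add: trig_sum_add trig_sum_cmult)
    also have "norm \<dots> \<le> (\<Sum>p\<in>{n<..d}. \<bar>b p * real p\<bar>) * M + \<bar>(q d - q (d + 1)) * real d\<bar> * M + q d * M"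
    proof (intro order_trans[OF norm_triangle_ineq] add_mono)
      show "norm (trig_sum d (\<lambda>j. of_real (W j) * c j) x) \<le> (\<Sum>p\<in>{n<..d}. \<bar>b p * real p\<bar>) * M"
        unfolding W_def by (rule norm_fejer_combination_le[OF M]) auto
      show "norm (trig_sum d (\<lambda>j. of_real (V j) * c j) x) \<le> \<bar>(q d - q (d + 1)) * real d\<bar> * M"
        using norm_fejer_combination_le[OF M, of "{d}" "\<lambda>p. p" "\<lambda>_. (q d - q (d + 1)) * real d" x] nd \<open>n \<ge> 1\<close>
        unfolding V_def by simp
      show "norm (of_real (q d) * trig_sum d c x) \<le> q d * M"
        using M by (simp add: norm_mult norm_divide norm_power q_def divide_right_mono)
    qed
    also have "(\<Sum>p\<in>{n<..d}. \<bar>b p * real p\<bar>) = (\<Sum>p\<in>{n<..d}. b p * real p)"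
    proof (intro sum.cong refl abs_of_nonneg mult_nonneg_nonneg)
      fix p assume "p \<in> {n<..d}"
      then show "0 \<le> b p" using inverse_square_convex[of p] \<open>n \<ge> 1\<close> by (simp add: b_def q_def)
    qed auto
    also have "\<bar>(q d - q (d + 1)) * real d\<bar> = (q d - q (d + 1)) * real d"
      using nd \<open>n \<ge> 1\<close> by (intro abs_of_nonneg mult_nonneg_nonneg) (auto simp: q_def field_simps)
    also have "(\<Sum>p\<in>{n<..d}. b p * real p) * M + (q d - q (d + 1)) * real d * M + q d * M =
        ((\<Sum>p\<in>{n<..d}. b p * real p) + (q d - q (d + 1)) * real d + q d) * M"
      by (simp add: algebra_simps)
    also have "\<dots> = (q n + real n * (q n - q (n + 1))) * M"
      using convex_sequence_total_mass[OF nd, of q] by (simp add: b_def)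
    \<comment> \<open>The first term is 1/n^2; the second is (2n+1)/(n (n+1)^2), which is at most
      2/n^2.\<close>
    also have "\<dots> \<le> 3 / (real n)\<^sup>2 * M"
    proof (rule mult_right_mono[OF _ \<open>0 \<le> M\<close>])
      define t where "t = real n"
      have "t \<ge> 1" using \<open>n \<ge> 1\<close> by (simp add: t_def)
      then show "q n + real n * (q n - q (n + 1)) \<le> 3 / (real n)\<^sup>2"
        unfolding q_def of_nat_add of_nat_1 t_def[symmetric]
        by (simp add: divide_simps) (simp add: power2_eq_square algebra_simps)
    qed
    finally show ?thesis .
  qed
qed

section \<open>Averaging a central difference over its step\<close>

text \<open>The centre \<open>p\<close> is decoupled from the radius \<open>k\<close> so that the
  induction can widen the window around a fixed centre.\<close>

lemma sum_around_middle:
  fixes F :: "nat \<Rightarrow> 'a::ab_group_add"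
  assumes "k \<le> p"
  shows "(\<Sum>i = p - k..p + k. F i) = F p + (\<Sum>i = 1..k. F (p + i) + F (p - i))"
  using assms
proof (induction k)
  case (Suc k)
  have "{p - Suc k..p + Suc k} = insert (p - Suc k) (insert (p + Suc k) {p - k..p + k})"
    using Suc.prems by auto
  moreover have "p - Suc k \<notin> insert (p + Suc k) {p - k..p + k}" "p + Suc k \<notin> {p - k..p + k}"
    using Suc.prems by auto
  ultimately have "(\<Sum>i = p - Suc k..p + Suc k. F i) = F (p - Suc k) + (F (p + Suc k) + (\<Sum>i = p - k..p + k. F i))"
    by simp
  then show ?case using Suc by (simp add: algebra_simps)
qed simp

text \<open>The factor \<open>(- 1) ^ k\<close> makes the middle coefficient positive. The point of
  the form is that the middle term is free of \<open>t\<close> and the others come in symmetric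
  pairs.\<close>

lemma central_difference_even:
  "(- 1) ^ k * central_difference (2 * k) t g x =
     of_nat ((2 * k) choose k) * g x +
     (\<Sum>i = 1..k. (- 1) ^ i * of_nat ((2 * k) choose (k + i)) * (g (x + real i * t) + g (x - real i * t)))"
proof -
  define F where "F i = (- 1) ^ (k + i) * of_nat ((2 * k) choose i) * g (x + (real i - real k) * t)" for i
  have sgn: "(- 1) ^ k * (- 1) ^ (2 * k - i) = ((- 1) ^ (k + i) :: complex)" if "i \<le> 2 * k" for i
    using that by (simp add: minus_one_power_iff)
  have "(- 1) ^ k * central_difference (2 * k) t g x = (\<Sum>i = k - k..k + k. F i)"
    unfolding central_difference_def sum_distrib_left
  proof (intro sum.cong)
    fix i assume "i \<in> {k - k..k + k}"
    then have "i \<le> 2 * k" by simp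
    have "x - real (2 * k) / 2 * t + real i * t = x + (real i - real k) * t"
      by (simp add: algebra_simps)
    then show "(- 1) ^ k * ((- 1) ^ (2 * k - i) * of_nat (2 * k choose i) *
        g (x - real (2 * k) / 2 * t + real i * t)) = F i"
      using sgn[OF \<open>i \<le> 2 * k\<close>] by (simp only: F_def mult.assoc[symmetric])
  qed auto
  also have "\<dots> = F k + (\<Sum>i = 1..k. F (k + i) + F (k - i))"
    by (rule sum_around_middle) simp
  also have "F k = of_nat ((2 * k) choose k) * g x"
    by (simp add: F_def flip: mult_2)
  also have "(\<Sum>i = 1..k. F (k + i) + F (k - i)) =
     (\<Sum>i = 1..k. (- 1) ^ i * of_nat ((2 * k) choose (k + i)) * (g (x + real i * t) + g (x - real i * t)))"
  proof (intro sum.cong refl)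
    fix i assume "i \<in> {1..k}"
    then have i: "i \<le> k" by simp
    have "(2 * k) choose (k - i) = (2 * k) choose (k + i)"
      using i binomial_symmetric[of "k + i" "2 * k"] by simp
    moreover have "(- 1) ^ (k + (k - i)) = ((- 1) ^ i :: complex)" "(- 1) ^ (k + (k + i)) = ((- 1) ^ i :: complex)"
      using i by (auto simp: minus_one_power_iff)
    moreover have "x + (real (k - i) - real k) * t = x - real i * t" "x + (real (k + i) - real k) * t = x + real i * t"
      using i by (auto simp: of_nat_diff algebra_simps)
    ultimately show "F (k + i) + F (k - i) =
        (- 1) ^ i * of_nat ((2 * k) choose (k + i)) * (g (x + real i * t) + g (x - real i * t))"
      unfolding F_def by (simp only: distrib_left)
  qed
  finally show ?thesis .
qed

lemma trig_sum_has_vector_derivative: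
  "(trig_sum d c has_vector_derivative trig_sum d (\<lambda>j. \<i> * of_int j * c j) x) (at x within S)"
proof -
  have "((\<lambda>x. \<Sum>j = - int d..int d. c j * cis (of_int j * x)) has_vector_derivative
      (\<Sum>j = - int d..int d. c j * (of_int j * (\<i> * cis (of_int j * x))))) (at x within S)"
    by (auto intro!: derivative_eq_intros simp: has_vector_derivative_def scaleR_conv_of_real
        sum_distrib_left algebra_simps)
  also have "(\<Sum>j = - int d..int d. c j * (of_int j * (\<i> * cis (of_int j * x)))) =
      trig_sum d (\<lambda>j. \<i> * of_int j * c j) x"
    unfolding trig_sum_def by (intro sum.cong refl) (simp add: algebra_simps)
  finally show ?thesis by (simp add: trig_sum_def[abs_def])
qed

lemma has_vector_derivative_affine:
  fixes G :: "real \<Rightarrow> complex"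
  assumes "\<And>x. (G has_vector_derivative G' x) (at x)"
  shows "((\<lambda>t. G (x + s * t)) has_vector_derivative of_real s * G' (x + s * t)) (at t)"
proof -
  have "((\<lambda>t. x + s * t) has_vector_derivative s) (at t)"
    by (auto intro!: derivative_eq_intros simp: has_vector_derivative_def)
  from vector_diff_chain_at[OF this assms] show ?thesis
    by (simp add: o_def scaleR_conv_of_real)
qed

text \<open>Integration by parts in \<open>t\<close>: differentiating \<open>h - t\<close> cancels
  the term left by the second antiderivative. The first summand vanishes at \<open>t = h\<close>
  and, by symmetry, at \<open>t = 0\<close>, so its increment over the interval is zero.\<close>

lemma smoothing_antiderivative:
  fixes G G' g :: "real \<Rightarrow> complex"
  assumes "\<And>x. (G has_vector_derivative G' x) (at x)" "\<And>x. (G' has_vector_derivative g x) (at x)"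
    and "s \<noteq> 0"
  shows "((\<lambda>t. of_real (h - t) * (G' (x + s * t) - G' (x - s * t)) / of_real s
            + (G (x + s * t) + G (x - s * t)) / of_real (s\<^sup>2))
          has_vector_derivative of_real (h - t) * (g (x + s * t) + g (x - s * t))) (at t)"
proof -
  have ht: "((\<lambda>t. complex_of_real (h - t)) has_vector_derivative - 1) (at t)"
    using has_vector_derivative_of_real[of "\<lambda>t. h - t" "- 1" "at t"]
    by (auto intro!: derivative_eq_intros simp: has_real_derivative_iff_has_vector_derivative[symmetric])
  have neg: "((\<lambda>t. F (x - s * t)) has_vector_derivative - of_real s * F' (x - s * t)) (at t)"
    if "\<And>x. (F has_vector_derivative F' x) (at x)" for F F' :: "real \<Rightarrow> complex"
    using has_vector_derivative_affine[OF that, of x "- s" t] by simp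
  have "((\<lambda>t. (of_real (h - t) * (G' (x + s * t) - G' (x - s * t))) * of_real (1 / s)
            + (G (x + s * t) + G (x - s * t)) * of_real (1 / s\<^sup>2))
          has_vector_derivative
          (of_real (h - t) * (of_real s * g (x + s * t) - - of_real s * g (x - s * t))
            + (- 1) * (G' (x + s * t) - G' (x - s * t))) * of_real (1 / s)
          + (of_real s * G' (x + s * t) + - of_real s * G' (x - s * t)) * of_real (1 / s\<^sup>2)) (at t)"
    by (intro has_vector_derivative_add has_vector_derivative_mult_left has_vector_derivative_mult
        has_vector_derivative_diff ht has_vector_derivative_affine[OF assms(1)] has_vector_derivative_affine[OF assms(2)]
        neg[OF assms(1)] neg[OF assms(2)])
  moreover have "(of_real (h - t) * (of_real s * g (x + s * t) - - of_real s * g (x - s * t))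
            + (- 1) * (G' (x + s * t) - G' (x - s * t))) * of_real (1 / s)
          + (of_real s * G' (x + s * t) + - of_real s * G' (x - s * t)) * of_real (1 / s\<^sup>2)
       = of_real (h - t) * (g (x + s * t) + g (x - s * t))"
    using assms(3) by (simp add: power2_eq_square field_simps)
  ultimately show ?thesis by (simp add: divide_inverse)
qed

text \<open>Averaging the difference over its step against the triangle kernel \<open>h - t\<close> turns the translates
  of \<open>g = G''\<close> into second differences of \<open>G\<close>.\<close>

lemma averaged_difference_bound:
  fixes G G' g :: "real \<Rightarrow> complex"
  assumes "\<And>x. (G has_vector_derivative G' x) (at x)" "\<And>x. (G' has_vector_derivative g x) (at x)"
    and "h > 0"
    and B: "\<And>t. 0 < t \<Longrightarrow> t < h \<Longrightarrow> norm (central_difference (2 * k) t g x) \<le> B"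
  shows "norm (of_nat ((2 * k) choose k) * g x * of_real (h\<^sup>2 / 2) +
     (\<Sum>i = 1..k. (- 1) ^ i * of_nat ((2 * k) choose (k + i)) *
        ((G (x + real i * h) + G (x - real i * h) - 2 * G x) / of_real ((real i)\<^sup>2)))) \<le> B * h\<^sup>2 / 2"
proof -
  define P where "P s t = of_real (h - t) * (G' (x + s * t) - G' (x - s * t)) / of_real s
            + (G (x + s * t) + G (x - s * t)) / of_real (s\<^sup>2)" for s t
  define a where "a i = (- 1) ^ i * complex_of_nat ((2 * k) choose (k + i))" for i
  \<comment> \<open>An explicit antiderivative of \<open>h - t\<close> times the signed difference;
    \<open>h * t - t\<^sup>2 / 2\<close> rises from 0 to h^2/2 and serves the constant middle
    term.\<close>
  define \<Phi> where "\<Phi> t = of_nat ((2 * k) choose k) * g x * of_real (h * t - t\<^sup>2 / 2) + (\<Sum>i = 1..k. a i * P (real i) t)" for t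
  have P: "(P (real i) has_vector_derivative of_real (h - t) * (g (x + real i * t) + g (x - real i * t))) (at t)"
    if "i \<in> {1..k}" for i t
    unfolding P_def using that by (intro smoothing_antiderivative[OF assms(1,2)]) auto
  have q: "((\<lambda>t. h * t - t\<^sup>2 / 2) has_real_derivative h - t) (at t)" for t
    by (rule DERIV_cong, (rule derivative_intros)+) simp_all
  have q': "((\<lambda>t. complex_of_real (h * t - t\<^sup>2 / 2)) has_vector_derivative of_real (h - t)) (at t)" for t
    by (rule has_vector_derivative_of_real) (rule q)
  have \<Phi>: "(\<Phi> has_vector_derivative of_real (h - t) * ((- 1) ^ k * central_difference (2 * k) t g x)) (at t)" for t
  proof -
    have "(\<Phi> has_vector_derivative of_nat ((2 * k) choose k) * g x * of_real (h - t) +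
       (\<Sum>i = 1..k. a i * (of_real (h - t) * (g (x + real i * t) + g (x - real i * t))))) (at t)"
      unfolding \<Phi>_def
    proof (rule has_vector_derivative_add)
      show "((\<lambda>t. of_nat ((2 * k) choose k) * g x * of_real (h * t - t\<^sup>2 / 2)) has_vector_derivative
          of_nat ((2 * k) choose k) * g x * of_real (h - t)) (at t)"
        by (rule has_vector_derivative_mult_right[OF q'])
      show "((\<lambda>t. \<Sum>i = 1..k. a i * P (real i) t) has_vector_derivative
          (\<Sum>i = 1..k. a i * (of_real (h - t) * (g (x + real i * t) + g (x - real i * t))))) (at t)"
        by (rule has_vector_derivative_sum, rule has_vector_derivative_mult_right, rule P)
    qed
    also have "of_nat ((2 * k) choose k) * g x * of_real (h - t) +
       (\<Sum>i = 1..k. a i * (of_real (h - t) * (g (x + real i * t) + g (x - real i * t)))) =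
       of_real (h - t) * ((- 1) ^ k * central_difference (2 * k) t g x)"
      unfolding central_difference_even a_def distrib_left sum_distrib_left
      by (rule arg_cong2[where f = "(+)"], simp, rule sum.cong) (simp_all add: mult_ac)
    finally show ?thesis .
  qed
  \<comment> \<open>Comparison with the real function \<open>B * (h * t - t\<^sup>2 / 2)\<close>,
    whose derivative dominates that of \<open>\<Phi>\<close>. The bound on the difference is
    required only on the open interval, which matches the strict inequality in the modulus.\<close>
  have "norm (\<Phi> h - \<Phi> 0) \<le> B * (h * h - h\<^sup>2 / 2) - B * (h * 0 - 0\<^sup>2 / 2)"
  proof (rule differentiable_bound_general[OF \<open>h > 0\<close>])
    show "continuous_on {0..h} \<Phi>"
      by (rule continuous_on_vector_derivative) (rule has_vector_derivative_at_within[OF \<Phi>])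
    show "continuous_on {0..h} (\<lambda>t. B * (h * t - t\<^sup>2 / 2))" by (auto intro!: continuous_intros)
    show "((\<lambda>t. B * (h * t - t\<^sup>2 / 2)) has_vector_derivative B * (h - t)) (at t)" for t
      using has_vector_derivative_mult_right[OF q[unfolded has_real_derivative_iff_has_vector_derivative]] .
    fix t assume "0 < t" "t < h"
    then show "norm (of_real (h - t) * ((- 1) ^ k * central_difference (2 * k) t g x)) \<le> B * (h - t)"
      using B by (simp add: norm_mult norm_power mult.commute mult_left_mono flip: of_real_diff)
  qed (rule \<Phi>)
  also have "B * (h * h - h\<^sup>2 / 2) - B * (h * 0 - 0\<^sup>2 / 2) = B * h\<^sup>2 / 2"
    by (simp add: power2_eq_square algebra_simps)
  also have "\<Phi> h - \<Phi> 0 = of_nat ((2 * k) choose k) * g x * of_real (h\<^sup>2 / 2) +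
     (\<Sum>i = 1..k. a i * (P (real i) h - P (real i) 0))"
    by (simp add: \<Phi>_def sum_subtractf algebra_simps power2_eq_square)
  also have "(\<lambda>i. P (real i) h - P (real i) 0) =
      (\<lambda>i. (G (x + real i * h) + G (x - real i * h) - 2 * G x) / of_real ((real i)\<^sup>2))"
    by (simp add: P_def diff_divide_distrib)
  finally show ?thesis by (simp only: a_def)
qed

section \<open>Size of the second-difference terms and the numerical constants\<close>

text \<open>The Leibniz estimate; peeling off the first term leaves minus the same sum for the
  shifted sequence, so both bounds must be carried through the induction together.\<close>

lemma alternating_sum_bounds:
  fixes b :: "nat \<Rightarrow> real"
  assumes "\<And>i. 0 \<le> b i" "\<And>i. b (Suc i) \<le> b i"
  shows "0 \<le> (\<Sum>i<n. (- 1) ^ i * b i) \<and> (\<Sum>i<n. (- 1) ^ i * b i) \<le> b 0"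
  using assms
proof (induction n arbitrary: b)
  case (Suc n)
  have "(\<Sum>i<Suc n. (- 1) ^ i * b i) = b 0 - (\<Sum>i<n. (- 1) ^ i * b (Suc i))"
    by (subst sum.lessThan_Suc_shift) (simp add: sum_negf)
  then show ?case using Suc.IH[of "\<lambda>i. b (Suc i)"] Suc.prems(2)[of 0] Suc.prems by fastforce
qed simp

lemma sum_inverse_squares_le: "(\<Sum>i = 1..k. 1 / (real i)\<^sup>2) \<le> pi\<^sup>2 / 6"
proof -
  have basel: "(\<lambda>i. 1 / (real i + 1)\<^sup>2) sums (pi\<^sup>2 / 6)"
    using inverse_squares_sums by (simp add: add.commute)
  have "(\<Sum>i = 1..k. 1 / (real i)\<^sup>2) = (\<Sum>i<k. 1 / (real i + 1)\<^sup>2)"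
    by (rule sum.reindex_bij_witness[of _ Suc "\<lambda>i. i - 1"]) (auto simp: add.commute)
  also have "\<dots> \<le> (\<Sum>i. 1 / (real i + 1)\<^sup>2)"
    using basel by (intro sum_le_suminf) (auto simp: sums_iff)
  also have "\<dots> = pi\<^sup>2 / 6" using basel by (simp add: sums_iff)
  finally show ?thesis .
qed

text \<open>The translates and the centre \<open>G x\<close> are estimated separately. The
  translates cost the full sum of \<open>b i\<close>, at most C pi^2/6, but the coefficient of
  \<open>G x\<close> alternates and costs only its first term, at most C. Bounding each second
  difference by \<open>4 * L\<close> would give pi^2/3 in place of pi^2/6 + 1, and then 4 pi^2,
  about 39.5, would exceed the available 3 pi^4/8, about 36.5.\<close>

lemma second_difference_sum_bound:
  fixes G :: "real \<Rightarrow> complex"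
  assumes "k \<ge> 1" and L: "\<And>x. norm (G x) \<le> L"
  shows "norm (\<Sum>i = 1..k. (- 1) ^ i * of_nat ((2 * k) choose (k + i)) *
        ((G (x + real i * h) + G (x - real i * h) - 2 * G x) / of_real ((real i)\<^sup>2)))
     \<le> 2 * real ((2 * k) choose (k + 1)) * (pi\<^sup>2 / 6 + 1) * L"
proof -
  define C where "C = real ((2 * k) choose (k + 1))"
  define b where "b i = real ((2 * k) choose (k + i)) / (real i)\<^sup>2" for i
  have "0 \<le> L" using L[of 0] norm_ge_zero order_trans by blast
  have dec: "(2 * k) choose (k + Suc i) \<le> (2 * k) choose (k + i)" for i
  proof (cases "k + Suc i \<le> 2 * k")
    case True
    then show ?thesis by (intro binomial_antimono) auto
  qed (simp add: binomial_eq_0)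
  have b0: "0 \<le> b i" for i by (simp add: b_def)
  \<comment> \<open>Monotonicity starts at index 1, since \<open>b 0\<close> is 0 by the convention
    for division by zero.\<close>
  have bdec: "b (Suc (Suc i)) \<le> b (Suc i)" for i
    unfolding b_def using dec[of "Suc i"] by (intro frac_le power_mono) auto
  have bC: "b i \<le> C * (1 / (real i)\<^sup>2)" if "i \<ge> 1" for i
  proof -
    have "(2 * k) choose (k + i) \<le> (2 * k) choose (k + 1)"
      using that
    proof (induction i rule: dec_induct)
      case (step i)
      show ?case by (rule order_trans[OF dec step.IH])
    qed simp
    then show ?thesis by (simp add: b_def C_def divide_right_mono)
  qed
  have "(\<Sum>i = 1..k. (- 1) ^ i * b i) = (\<Sum>i<k. (- 1) ^ Suc i * b (Suc i))"
    by (rule sum.reindex_bij_witness[of _ Suc "\<lambda>i. i - 1"]) auto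
  also have "\<dots> = - (\<Sum>i<k. (- 1) ^ i * b (Suc i))" by (simp add: sum_negf)
  also have "\<bar>\<dots>\<bar> \<le> b 1"
    using alternating_sum_bounds[of "\<lambda>i. b (Suc i)" k] b0 bdec by simp
  finally have alt: "\<bar>\<Sum>i = 1..k. (- 1) ^ i * b i\<bar> \<le> C"
    using bC[of 1] by simp
  have "(\<Sum>i = 1..k. b i) \<le> (\<Sum>i = 1..k. C * (1 / (real i)\<^sup>2))"
    by (intro sum_mono bC) auto
  also have "\<dots> \<le> C * (pi\<^sup>2 / 6)"
    unfolding sum_distrib_left[symmetric] by (intro mult_left_mono sum_inverse_squares_le) (simp add: C_def)
  finally have bsum: "(\<Sum>i = 1..k. b i) \<le> C * (pi\<^sup>2 / 6)" .
  have "(\<Sum>i = 1..k. (- 1) ^ i * of_nat ((2 * k) choose (k + i)) *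
        ((G (x + real i * h) + G (x - real i * h) - 2 * G x) / of_real ((real i)\<^sup>2))) =
     (\<Sum>i = 1..k. of_real ((- 1) ^ i * b i) * (G (x + real i * h) + G (x - real i * h)))
      - of_real (\<Sum>i = 1..k. (- 1) ^ i * b i) * (2 * G x)"
    unfolding of_real_sum sum_distrib_right sum_subtractf[symmetric]
    by (intro sum.cong refl) (simp add: b_def diff_divide_distrib add_divide_distrib algebra_simps)
  also have "norm \<dots> \<le> (\<Sum>i = 1..k. b i * (2 * L)) + C * (2 * L)"
  proof (intro order_trans[OF norm_triangle_ineq4] add_mono sum_norm_le)
    fix i
    have "norm (G (x + real i * h) + G (x - real i * h)) \<le> 2 * L"
      using norm_triangle_mono[OF L L] by simp
    then show "norm (of_real ((- 1) ^ i * b i) * (G (x + real i * h) + G (x - real i * h))) \<le> b i * (2 * L)"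
      by (simp add: norm_mult norm_power b0 abs_mult mult_left_mono)
  next
    show "norm (of_real (\<Sum>i = 1..k. (- 1) ^ i * b i) * (2 * G x)) \<le> C * (2 * L)"
      unfolding norm_mult norm_of_real using alt L \<open>0 \<le> L\<close>
      by (intro mult_mono) (auto simp: C_def)
  qed
  also have "\<dots> \<le> C * (pi\<^sup>2 / 6) * (2 * L) + C * (2 * L)"
    using bsum \<open>0 \<le> L\<close> unfolding sum_distrib_right[symmetric] by (intro add_mono mult_right_mono) auto
  also have "\<dots> = 2 * C * (pi\<^sup>2 / 6 + 1) * L" by (simp add: algebra_simps)
  finally show ?thesis by (simp only: C_def)
qed

text \<open>Both (k+1) C(2k,k+1) and k C(2k,k) equal 2k C(2k-1,k). This ratio is the contraction
  factor of the absorption argument.\<close>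

lemma central_binomial_neighbour:
  assumes "k \<ge> 1"
  shows "real ((2 * k) choose (k + 1)) = real k / (real k + 1) * real ((2 * k) choose k)"
proof -
  have "2 * k - k = k" by simp
  then have "k * ((2 * k) choose k) = 2 * k * ((2 * k - 1) choose k)"
    using binomial_absorb_comp[of "2 * k" k] by metis
  moreover have "Suc k * ((2 * k) choose Suc k) = 2 * k * ((2 * k - 1) choose k)"
    using Suc_times_binomial[of k "2 * k - 1"] assms by simp
  ultimately have "(k + 1) * ((2 * k) choose (k + 1)) = k * ((2 * k) choose k)" by (simp only: Suc_eq_plus1)
  then have "real ((k + 1) * ((2 * k) choose (k + 1))) = real (k * ((2 * k) choose k))"
    by (simp only: of_nat_eq_iff)
  then have "(real k + 1) * real ((2 * k) choose (k + 1)) = real k * real ((2 * k) choose k)"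
    by (simp only: of_nat_mult of_nat_add of_nat_1)
  then show ?thesis by (simp add: field_simps)
qed

text \<open>The 12 is 2 * 2 * 3: from dividing by h^2/2, from the two translates of a pair, and from
  the antiderivative bound. Only pi > 3 enters: 3 pi^4/8 is at least 27 pi^2/8, which exceeds 2 pi^2
  by 11 pi^2/8, that is by at least 99/8 > 12.\<close>

lemma contraction_constant:
  assumes "3 * pi ^ 4 / 8 \<le> u"
  shows "12 * (pi\<^sup>2 / 6 + 1) / u \<le> 1"
proof -
  have nine: "pi\<^sup>2 \<ge> 9" using power_mono[of 3 pi 2] pi_gt3 by simp
  have "9 * pi\<^sup>2 \<le> pi\<^sup>2 * pi\<^sup>2" by (rule mult_right_mono[OF nine zero_le_power2])
  also have "pi\<^sup>2 * pi\<^sup>2 = pi ^ 4" by (simp only: power2_eq_square power4_eq_xxxx mult.assoc)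
  finally have "9 * pi\<^sup>2 \<le> pi ^ 4" .
  moreover have "12 * (p / 6 + 1) \<le> u \<and> u > 0" if "9 \<le> p" "9 * p \<le> q" "3 * q / 8 \<le> u" for p q :: real
    using that by simp
  ultimately have "12 * (pi\<^sup>2 / 6 + 1) \<le> u" "u > 0" using nine assms by blast+
  then show ?thesis using pos_divide_le_eq[of u] by simp
qed

section \<open>Functions without low frequencies: absorption of the error term\<close>

lemma high_frequency_step:
  assumes "k \<ge> 1" "n \<ge> 1" "h > 0" "3 * pi ^ 4 / 8 \<le> (h * real n)\<^sup>2"
    and low: "\<And>j. \<bar>j\<bar> < int n \<Longrightarrow> c j = 0"
    and M: "\<And>x. norm (trig_sum d c x) \<le> M"
    and B: "\<And>t. 0 < t \<Longrightarrow> t < h \<Longrightarrow> norm (central_difference (2 * k) t (trig_sum d c) x) \<le> B"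
  shows "norm (trig_sum d c x) \<le> B / real ((2 * k) choose k) + real k / (real k + 1) * M"
proof -
  have "0 \<le> M" using M[of 0] norm_ge_zero order_trans by blast
  \<comment> \<open>The sign comes from differentiating twice, which multiplies by -j^2. At
    \<open>j = 0\<close> the quotient is 0 by convention, which is consistent because
    \<open>c 0 = 0\<close>.\<close>
  define e where "e j = (- 1) * (c j / (of_int j)\<^sup>2)" for j
  define C where "C = real ((2 * k) choose k)"
  define g where "g = trig_sum d c"
  define G where "G = trig_sum d e"
  define G' where "G' = trig_sum d (\<lambda>j. \<i> * of_int j * e j)"
  have "C > 0" by (simp add: C_def)
  have "c 0 = 0" using low[of 0] \<open>n \<ge> 1\<close> by simp
  then have "c j = \<i> * of_int j * (\<i> * of_int j * e j)" for j
    by (cases "j = 0") (auto simp: e_def field_simps power2_eq_square)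
  then have g: "g = trig_sum d (\<lambda>j. \<i> * of_int j * (\<i> * of_int j * e j))"
    unfolding g_def by (intro arg_cong[where f = "trig_sum d"] ext)
  have der: "(G has_vector_derivative G' y) (at y)" "(G' has_vector_derivative g y) (at y)" for y
    unfolding G_def G'_def g by (rule trig_sum_has_vector_derivative)+
  have G: "norm (G y) \<le> 3 / (real n)\<^sup>2 * M" for y
    using second_antiderivative_bound[OF M low \<open>n \<ge> 1\<close>, of y]
    unfolding G_def e_def trig_sum_cmult[symmetric] by simp
  define S where "S = (\<Sum>i = 1..k. (- 1) ^ i * of_nat ((2 * k) choose (k + i)) *
        ((G (x + real i * h) + G (x - real i * h) - 2 * G x) / of_real ((real i)\<^sup>2)))"
  have "norm (of_nat ((2 * k) choose k) * g x * of_real (h\<^sup>2 / 2) + S) \<le> B * h\<^sup>2 / 2"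
    unfolding S_def by (rule averaged_difference_bound[OF der \<open>h > 0\<close>]) (use B g_def in auto)
  moreover have "norm S \<le> 2 * (real k / (real k + 1) * C) * (pi\<^sup>2 / 6 + 1) * (3 / (real n)\<^sup>2 * M)"
    using second_difference_sum_bound[where x = x and h = h, OF \<open>k \<ge> 1\<close> G]
    unfolding S_def C_def central_binomial_neighbour[OF \<open>k \<ge> 1\<close>] .
  moreover have "norm (of_nat ((2 * k) choose k) * g x * of_real (h\<^sup>2 / 2)) = C * norm (g x) * h\<^sup>2 / 2"
    by (simp add: norm_mult norm_divide norm_power C_def)
  moreover have "norm (of_nat ((2 * k) choose k) * g x * of_real (h\<^sup>2 / 2)) \<le>
      norm (of_nat ((2 * k) choose k) * g x * of_real (h\<^sup>2 / 2) + S) + norm S"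
    using norm_triangle_ineq4[of "of_nat ((2 * k) choose k) * g x * of_real (h\<^sup>2 / 2) + S" S] by simp
  ultimately have "C * norm (g x) * h\<^sup>2 / 2 \<le>
      B * h\<^sup>2 / 2 + 2 * (real k / (real k + 1) * C) * (pi\<^sup>2 / 6 + 1) * (3 / (real n)\<^sup>2 * M)"
    by linarith
  \<comment> \<open>Pure algebra with opaque letters: \<open>r\<close> stands for the norm of
    \<open>g x\<close>, \<open>q\<close> for k/(k+1), \<open>w\<close> for pi^2/6 + 1 and
    \<open>u\<close> for \<open>n\<close>.\<close>
  moreover have "r \<le> B / C + q * M * (12 * w / (h * u)\<^sup>2)"
    if "C * r * h\<^sup>2 / 2 \<le> B * h\<^sup>2 / 2 + 2 * (q * C) * w * (3 / u\<^sup>2 * M)" for q w u r :: real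
  proof -
    have "C * h\<^sup>2 > 0" using \<open>C > 0\<close> \<open>h > 0\<close> by simp
    have "r * (C * h\<^sup>2) \<le> B * h\<^sup>2 + 12 * (q * C) * w * M / u\<^sup>2"
      using that by (simp add: algebra_simps)
    then have "r \<le> (B * h\<^sup>2 + 12 * (q * C) * w * M / u\<^sup>2) / (C * h\<^sup>2)"
      using pos_le_divide_eq[OF \<open>C * h\<^sup>2 > 0\<close>] by blast
    also have "\<dots> = B / C + q * M * (12 * w / (h * u)\<^sup>2)"
      using \<open>C > 0\<close> \<open>h > 0\<close> by (simp add: add_divide_distrib power_mult_distrib mult_ac)
    finally show ?thesis .
  qed
  ultimately have "norm (g x) \<le> B / C + real k / (real k + 1) * M * (12 * (pi\<^sup>2 / 6 + 1) / (h * real n)\<^sup>2)"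
    by blast
  also have "\<dots> \<le> B / C + real k / (real k + 1) * M * 1"
    using \<open>0 \<le> M\<close> by (intro add_left_mono mult_left_mono contraction_constant assms) auto
  finally show ?thesis by (simp add: g_def C_def)
qed

lemma trig_sum_bounded: "norm (trig_sum d c x) \<le> (\<Sum>j = - int d..int d. norm (c j))"
  unfolding trig_sum_def by (rule order_trans[OF norm_sum]) (simp add: norm_mult)

text \<open>The pointwise step is applied at every \<open>x\<close> and the supremum
  \<open>M\<close> taken on the left. Since \<open>M\<close> is finite, k/(k+1) M can be subtracted,
  leaving M/(k+1).\<close>

lemma high_frequency_bound:
  assumes "k \<ge> 1" "n \<ge> 1" "h > 0" "3 * pi ^ 4 / 8 \<le> (h * real n)\<^sup>2"
    and "\<And>j. \<bar>j\<bar> < int n \<Longrightarrow> c j = 0"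
    and B: "\<And>t x. 0 < t \<Longrightarrow> t < h \<Longrightarrow> norm (central_difference (2 * k) t (trig_sum d c) x) \<le> B"
  shows "norm (trig_sum d c x) \<le> (real k + 1) * B / real ((2 * k) choose k)"
proof -
  define M where "M = (SUP x. norm (trig_sum d c x))"
  have M: "norm (trig_sum d c x) \<le> M" for x
    unfolding M_def by (intro cSUP_upper bdd_aboveI2[OF trig_sum_bounded]) auto
  have "M \<le> B / real ((2 * k) choose k) + real k / (real k + 1) * M"
    unfolding M_def
    by (rule cSUP_least, simp, fold M_def, rule high_frequency_step[OF assms(1-5) M]) (use B in auto)
  moreover have "M - real k / (real k + 1) * M = M / (real k + 1)"
    by (simp add: field_simps)
  ultimately have "M / (real k + 1) \<le> B / real ((2 * k) choose k)" by linarith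
  then have "M \<le> (real k + 1) * B / real ((2 * k) choose k)"
    by (simp add: pos_divide_le_eq mult.commute)
  then show ?thesis using M[of x] by linarith
qed

section \<open>Fourier sums and Vallee Poussin means as multipliers\<close>

lemma cis_int_pi: "cis (of_int l * pi) = cis (- (of_int l * pi))"
proof -
  have "cis (of_int l * pi) = cis (- (of_int l * pi)) * cis (2 * pi * of_int l)"
    by (simp only: cis_mult) (simp add: algebra_simps)
  then show ?thesis by simp
qed

lemma integral_cis_int:
  "integral {- pi..pi} (\<lambda>t. cis (of_int l * t)) = (if l = 0 then 2 * of_real pi else 0)"
proof (cases "l = 0")
  case True
  then show ?thesis by (simp add: scaleR_conv_of_real)
next
  case False
  have "((\<lambda>t. cis (of_int l * t) / (\<i> * of_int l)) has_vector_derivative cis (of_int l * t)) (at t within {- pi..pi})" for t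
  proof -
    have "((\<lambda>t. cis (of_int l * t)) has_vector_derivative of_int l * (\<i> * cis (of_int l * t))) (at t within {- pi..pi})"
      by (auto intro!: derivative_eq_intros simp: has_vector_derivative_def scaleR_conv_of_real algebra_simps)
    from has_vector_derivative_mult_left[OF this, of "1 / (\<i> * of_int l)"] show ?thesis
      using False by (simp add: field_simps)
  qed
  from fundamental_theorem_of_calculus[OF _ this]
  have "((\<lambda>t. cis (of_int l * t)) has_integral
      cis (of_int l * pi) / (\<i> * of_int l) - cis (of_int l * - pi) / (\<i> * of_int l)) {- pi..pi}"
    by simp
  then show ?thesis using False cis_int_pi[of l] by (simp add: integral_unique)
qed

lemma fourier_coeff_trig_sum: "fourier_coeff (trig_sum d c) j = (if \<bar>j\<bar> \<le> int d then c j else 0)"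
proof -
  have "trig_sum d c t * exp (- \<i> * of_int j * complex_of_real t) =
      (\<Sum>l = - int d..int d. c l * cis (of_int (l - j) * t))" for t
  proof -
    have "exp (- \<i> * of_int j * complex_of_real t) = cis (- of_int j * t)"
      by (simp add: cis_conv_exp mult_ac)
    then show ?thesis
      unfolding trig_sum_def sum_distrib_right
      by (intro sum.cong refl) (simp add: mult.assoc cis_mult left_diff_distrib)
  qed
  then have "integral {- pi..pi} (\<lambda>t. trig_sum d c t * exp (- \<i> * of_int j * complex_of_real t)) =
      integral {- pi..pi} (\<lambda>t. \<Sum>l = - int d..int d. c l * cis (of_int (l - j) * t))"
    by simp
  also have "\<dots> = (\<Sum>l = - int d..int d. c l * integral {- pi..pi} (\<lambda>t. cis (of_int (l - j) * t)))"
  proof (subst integral_sum)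
    show "(\<lambda>t. c l * cis (of_int (l - j) * t)) integrable_on {- pi..pi}" for l
      by (intro integrable_continuous_interval continuous_intros)
  qed auto
  also have "\<dots> = (\<Sum>l = - int d..int d. if l = j then c j * (2 * of_real pi) else 0)"
    unfolding integral_cis_int by (rule sum.cong) auto
  also have "\<dots> = (if \<bar>j\<bar> \<le> int d then c j * (2 * of_real pi) else 0)"
    by (auto simp: sum.delta)
  finally show ?thesis by (simp add: fourier_coeff_def)
qed

lemma fourier_partial_sum_trig_sum:
  "fourier_partial_sum i (trig_sum d c) x = trig_sum d (\<lambda>j. (if \<bar>j\<bar> \<le> int i then 1 else 0) * c j) x"
proof -
  have "fourier_partial_sum i (trig_sum d c) x =
      (\<Sum>j = - int i..int i. if j \<in> {- int d..int d} then c j * cis (of_int j * x) else 0)"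
    unfolding fourier_partial_sum_def
    by (intro sum.cong refl) (auto simp: fourier_coeff_trig_sum cis_conv_exp mult_ac)
  also have "\<dots> = (\<Sum>j\<in>{- int i..int i} \<inter> {- int d..int d}. c j * cis (of_int j * x))"
    by (simp only: sum.inter_restrict finite_atLeastAtMost_int)
  also have "\<dots> = (\<Sum>j\<in>{- int d..int d} \<inter> {- int i..int i}. c j * cis (of_int j * x))"
    by (simp only: Int_commute)
  also have "\<dots> = (\<Sum>j = - int d..int d. if j \<in> {- int i..int i} then c j * cis (of_int j * x) else 0)"
    by (simp only: sum.inter_restrict finite_atLeastAtMost_int)
  also have "\<dots> = trig_sum d (\<lambda>j. (if \<bar>j\<bar> \<le> int i then 1 else 0) * c j) x"
    unfolding trig_sum_def by (intro sum.cong refl) auto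
  finally show ?thesis .
qed

text \<open>For positive \<open>k\<close> and \<open>m\<close> this is the trapezoid equal to 1 up
  to \<open>k * m\<close> and 0 from \<open>(k + 1) * m\<close> on; as a combination of Fejer
  weights it inherits their norm bound.\<close>

definition vallee_poussin_weight :: "nat \<Rightarrow> nat \<Rightarrow> int \<Rightarrow> real" where
  "vallee_poussin_weight k m j =
     (real k + 1) * fejer_weight ((k + 1) * m) j - real k * fejer_weight (k * m) j"

text \<open>Frequency \<open>j\<close> is kept by those partial sums with index at least |j|.
  Cutting the index interval at |j| leaves a length that is the difference of two truncated linear
  functions, that is, of two rescaled Fejer weights.\<close>

lemma card_frequencies_above:
  assumes "k \<ge> 1" "m \<ge> 1"
  shows "real (card {i \<in> {k * m..<(k + 1) * m}. \<bar>j\<bar> \<le> int i}) = real m * vallee_poussin_weight k m j"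
proof -
  have w: "real m * vallee_poussin_weight k m j =
      max 0 (real ((k + 1) * m) - \<bar>of_int j\<bar>) - max 0 (real (k * m) - \<bar>of_int j\<bar>)"
    using mult_fejer_weight[of "(k + 1) * m" j] mult_fejer_weight[of "k * m" j] assms
    by (simp add: vallee_poussin_weight_def algebra_simps)
  define a where "a = nat \<bar>j\<bar>"
  have j: "\<bar>j\<bar> = int a" "\<bar>real_of_int j\<bar> = real a" by (auto simp: a_def)
  have "{i \<in> {k * m..<(k + 1) * m}. \<bar>j\<bar> \<le> int i} = {max (k * m) a..<(k + 1) * m}"
    by (auto simp: j)
  moreover have "real (q - max p a) = max 0 (real q - real a) - max 0 (real p - real a)" if "p \<le> q" for p q
    using that by (auto simp: max_def of_nat_diff)
  from this[of "k * m" "(k + 1) * m"]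
  have "real ((k + 1) * m - max (k * m) a) = max 0 (real ((k + 1) * m) - real a) - max 0 (real (k * m) - real a)"
    by simp
  ultimately show ?thesis by (simp only: w j card_atLeastLessThan)
qed

lemma vallee_poussin_mean_trig_sum:
  assumes "k \<ge> 1" "m \<ge> 1"
  shows "vallee_poussin_mean k m (trig_sum d c) x =
    trig_sum d (\<lambda>j. of_real (vallee_poussin_weight k m j) * c j) x"
proof -
  have "vallee_poussin_mean k m (trig_sum d c) x =
      trig_sum d (\<lambda>j. 1 / of_nat m * (\<Sum>i = k * m..<(k + 1) * m. (if \<bar>j\<bar> \<le> int i then 1 else 0) * c j)) x"
    unfolding vallee_poussin_mean_def fourier_partial_sum_trig_sum trig_sum_sum trig_sum_cmult ..
  also have "\<dots> = trig_sum d (\<lambda>j. of_real (vallee_poussin_weight k m j) * c j) x"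
  proof (rule trig_sum_cong)
    fix j
    have "(\<Sum>i = k * m..<(k + 1) * m. (if \<bar>j\<bar> \<le> int i then 1 else 0) * c j) =
        of_real (real (card {i \<in> {k * m..<(k + 1) * m}. \<bar>j\<bar> \<le> int i})) * c j"
      unfolding sum_distrib_right[symmetric] by (simp add: sum.If_cases Int_def)
    then show "1 / of_nat m * (\<Sum>i = k * m..<(k + 1) * m. (if \<bar>j\<bar> \<le> int i then 1 else 0) * c j) =
        of_real (vallee_poussin_weight k m j) * c j"
      unfolding card_frequencies_above[OF assms] using assms by simp
  qed
  finally show ?thesis .
qed

lemma vallee_poussin_weight_low:
  assumes "k \<ge> 1" "m \<ge> 1" "\<bar>j\<bar> \<le> int (k * m)"
  shows "vallee_poussin_weight k m j = 1"
proof -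
  have "{i \<in> {k * m..<(k + 1) * m}. \<bar>j\<bar> \<le> int i} = {k * m..<(k + 1) * m}"
  proof -
    have "\<bar>j\<bar> \<le> int i" if "k * m \<le> i" for i
      by (rule order_trans[OF assms(3)]) (simp only: of_nat_le_iff that)
    then show ?thesis by auto
  qed
  then show ?thesis using card_frequencies_above[OF assms(1,2), of j] assms(2) by simp
qed

lemma vallee_poussin_remainder_bound:
  assumes "k \<ge> 1" "m \<ge> 1" and M: "\<And>x. norm (trig_sum d c x) \<le> M"
  shows "norm (trig_sum d (\<lambda>j. of_real (1 - vallee_poussin_weight k m j) * c j) x) \<le> 2 * (real k + 1) * M"
proof -
  let ?F = "\<lambda>p. trig_sum d (\<lambda>j. of_real (fejer_weight p j) * c j) x"
  have "trig_sum d (\<lambda>j. of_real (1 - vallee_poussin_weight k m j) * c j) x =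
      trig_sum d c x - of_real (real k + 1) * ?F ((k + 1) * m) + of_real (real k) * ?F (k * m)"
    unfolding trig_sum_cmult trig_sum_diff trig_sum_add
    by (rule trig_sum_cong) (simp add: vallee_poussin_weight_def algebra_simps)
  also have "norm \<dots> \<le> M + (real k + 1) * M + real k * M"
  proof (intro order_trans[OF norm_triangle_ineq] order_trans[OF norm_triangle_ineq4] add_mono M)
    show "norm (of_real (real k + 1) * ?F ((k + 1) * m)) \<le> (real k + 1) * M"
      unfolding norm_mult norm_of_real using norm_fejer_sum_le[OF M, of "(k + 1) * m" x] assms
      by (auto intro!: mult_left_mono)
    show "norm (of_real (real k) * ?F (k * m)) \<le> real k * M"
      unfolding norm_mult norm_of_real using norm_fejer_sum_le[OF M, of "k * m" x] assms
      by (auto intro!: mult_left_mono)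
  qed
  also have "\<dots> = 2 * (real k + 1) * M" by (simp add: algebra_simps)
  finally show ?thesis .
qed

lemma central_difference_trig_sum:
  "central_difference r t (trig_sum d c) x = trig_sum d (\<lambda>j. (\<Sum>i = 0..r. (- 1) ^ (r - i) * of_nat (r choose i) *
     cis (of_int j * (- (real r / 2) * t + real i * t))) * c j) x"
proof -
  have "central_difference r t (trig_sum d c) x = (\<Sum>i = 0..r. (- 1) ^ (r - i) * of_nat (r choose i) *
      trig_sum d (\<lambda>j. c j * cis (of_int j * (- (real r / 2) * t + real i * t))) x)"
    unfolding central_difference_def trig_sum_shift[symmetric] by (simp add: algebra_simps)
  then show ?thesis
    unfolding trig_sum_cmult trig_sum_sum sum_distrib_right by (simp add: mult_ac)
qed

lemma trig_sum_approximation: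
  assumes "k \<ge> 1" "m \<ge> 1" "h > 0" "3 * pi ^ 4 / 8 \<le> (h * real (k * m))\<^sup>2"
    and B: "\<And>t x. \<bar>t\<bar> < h \<Longrightarrow> norm (central_difference (2 * k) t (trig_sum d c) x) \<le> B"
  shows "norm (trig_sum d c x - vallee_poussin_mean k m (trig_sum d c) x)
     \<le> 2 * (real k + 1)\<^sup>2 / real ((2 * k) choose k) * B"
proof -
  define r where "r j = of_real (1 - vallee_poussin_weight k m j) * c j" for j
  have "trig_sum d c x - vallee_poussin_mean k m (trig_sum d c) x = trig_sum d r x"
    unfolding vallee_poussin_mean_trig_sum[OF assms(1,2)] trig_sum_diff
    by (rule trig_sum_cong) (simp add: r_def left_diff_distrib)
  also have "norm \<dots> \<le> (real k + 1) * (2 * (real k + 1) * B) / real ((2 * k) choose k)"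
  proof (rule high_frequency_bound[OF \<open>k \<ge> 1\<close> _ assms(3,4)])
    show "1 \<le> k * m" using assms(1,2) by simp
    show "r j = 0" if "\<bar>j\<bar> < int (k * m)" for j
      using that vallee_poussin_weight_low[OF assms(1,2), of j] by (simp add: r_def)
    fix t x :: real assume t: "0 < t" "t < h"
    define \<delta> where "\<delta> j = (\<Sum>i = 0..2 * k. (- 1) ^ (2 * k - i) * complex_of_nat ((2 * k) choose i) *
       cis (of_int j * (- (real (2 * k) / 2) * t + real i * t)))" for j
    \<comment> \<open>The difference of the sum is itself a trigonometric sum with multiplier
      \<open>\<delta>\<close>. The remainder operator is applied to it, and commuting the two
      multipliers bounds the difference of the remainder.\<close>
    have "norm (trig_sum d (\<lambda>j. \<delta> j * c j) y) \<le> B" for y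
      using B[of t y] t unfolding central_difference_trig_sum \<delta>_def by simp
    from vallee_poussin_remainder_bound[OF assms(1,2) this, of x]
    show "norm (central_difference (2 * k) t (trig_sum d r) x) \<le> 2 * (real k + 1) * B"
      unfolding central_difference_trig_sum r_def \<delta>_def by (simp only: mult_ac)
  qed
  finally show ?thesis by (simp add: power2_eq_square algebra_simps)
qed

section \<open>Density of trigonometric polynomials\<close>

text \<open>A form free of degrees, in which closure under products is a short induction;
  \<open>trig_polynomial_eq_trig_sum\<close> restores the degree afterwards.\<close>

inductive trig_polynomial :: "(real \<Rightarrow> complex) \<Rightarrow> bool" where
  monomial: "trig_polynomial (\<lambda>x. a * cis (of_int j * x))"
| add: "trig_polynomial p \<Longrightarrow> trig_polynomial q \<Longrightarrow> trig_polynomial (\<lambda>x. p x + q x)"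

lemma trig_polynomial_const: "trig_polynomial (\<lambda>x. a)"
  using trig_polynomial.monomial[of a 0] by simp

lemma trig_polynomial_mult:
  assumes "trig_polynomial p" "trig_polynomial q"
  shows "trig_polynomial (\<lambda>x. p x * q x)"
  using assms
proof (induction p rule: trig_polynomial.induct)
  case (monomial a j)
  from monomial show ?case
  proof (induction q rule: trig_polynomial.induct)
    case (monomial b l)
    have "(\<lambda>x. a * cis (of_int j * x) * (b * cis (of_int l * x))) = (\<lambda>x. a * b * cis (of_int (j + l) * x))"
      by (auto simp: algebra_simps simp flip: cis_mult)
    then show ?case by (metis trig_polynomial.monomial)
  next
    case (add p q)
    then show ?case using trig_polynomial.add by (simp add: distrib_left)
  qed
next
  case (add p q')
  then show ?case using trig_polynomial.add by (simp add: distrib_right)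
qed

lemma trig_sum_extend:
  assumes "d \<le> e"
  shows "trig_sum d c x = trig_sum e (\<lambda>j. if \<bar>j\<bar> \<le> int d then c j else 0) x"
proof -
  have "(\<Sum>j = - int d..int d. c j * cis (of_int j * x)) =
      (\<Sum>j = - int e..int e. (if \<bar>j\<bar> \<le> int d then c j else 0) * cis (of_int j * x))"
    using assms by (intro sum.mono_neutral_cong_left) auto
  then show ?thesis by (simp add: trig_sum_def)
qed

lemma trig_polynomial_eq_trig_sum:
  assumes "trig_polynomial p"
  obtains d c where "p = trig_sum d c"
proof -
  have "\<exists>d c. \<forall>x. p x = trig_sum d c x"
    using assms
  proof (induction rule: trig_polynomial.induct)
    case (monomial a j)
    have "trig_sum (nat \<bar>j\<bar>) (\<lambda>l. if l = j then a else 0) x = a * cis (of_int j * x)" for x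
    proof -
      have "trig_sum (nat \<bar>j\<bar>) (\<lambda>l. if l = j then a else 0) x =
          (\<Sum>l = - int (nat \<bar>j\<bar>)..int (nat \<bar>j\<bar>). if l = j then a * cis (of_int j * x) else 0)"
        unfolding trig_sum_def by (intro sum.cong) auto
      then show ?thesis by (auto simp: sum.delta)
    qed
    then show ?case by metis
  next
    case (add p q)
    then obtain d c e b where *: "\<And>x. p x = trig_sum d c x" "\<And>x. q x = trig_sum e b x" by metis
    show ?case
      unfolding * trig_sum_extend[OF max.cobounded1[of d e]] trig_sum_extend[OF max.cobounded2[of e d]]
        trig_sum_add by blast
  qed
  then show thesis using that by blast
qed

text \<open>On the unit circle a real linear functional is a combination of cos and sin, hence of
  frequencies 1 and -1 by Euler's formulas; sums and products follow by closure.\<close>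

lemma real_polynomial_function_cis:
  assumes "real_polynomial_function p"
  shows "trig_polynomial (\<lambda>x. of_real (p (cis x)))"
  using assms
proof (induction rule: real_polynomial_function.induct)
  case (linear p)
  have p: "p (cis x) = cos x * p 1 + sin x * p \<i>" for x
  proof -
    have "cis x = cos x *\<^sub>R 1 + sin x *\<^sub>R \<i>" by (simp add: complex_eq_iff)
    then show ?thesis
      by (simp only: linear_add[OF bounded_linear.linear[OF linear]]
          linear_scale[OF bounded_linear.linear[OF linear]] real_scaleR_def)
  qed
  define a b where "a = complex_of_real (p 1)" and "b = complex_of_real (p \<i>)"
  have "complex_of_real (p (cis x)) = (a - \<i> * b) / 2 * cis (of_int 1 * x) + (a + \<i> * b) / 2 * cis (of_int (- 1) * x)" for x
    by (simp add: p a_def b_def complex_eq_iff field_simps)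
  then show ?case
    using trig_polynomial.add[OF trig_polynomial.monomial[of "(a - \<i> * b) / 2" 1] trig_polynomial.monomial[of "(a + \<i> * b) / 2" "- 1"]]
    by simp
next
  case (const a)
  show ?case by (rule trig_polynomial_const)
next
  case (add f g)
  then show ?case using trig_polynomial.add by simp
next
  case (mult f g)
  then show ?case using trig_polynomial_mult by simp
qed

lemma periodic_int:
  fixes f :: "real \<Rightarrow> complex" and n :: int
  assumes "\<And>x. f (x + 2 * pi) = f x"
  shows "f (x + of_int n * (2 * pi)) = f x"
proof (induction n arbitrary: x rule: int_induct[of _ 0])
  case (step1 i)
  then show ?case using assms[of "x + of_int i * (2 * pi)"] by (simp add: algebra_simps)
next
  case (step2 i)
  then show ?case using assms[of "x + of_int (i - 1) * (2 * pi)"] by (simp add: algebra_simps)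
qed simp

lemma periodic_representative:
  fixes x :: real
  obtains n :: int where "x + of_int n * (2 * pi) \<in> {- pi..<pi}"
proof -
  define n where "n = - \<lfloor>(x + pi) / (2 * pi)\<rfloor>"
  have "of_int (- n) \<le> (x + pi) / (2 * pi)" "(x + pi) / (2 * pi) < of_int (- n) + 1"
    unfolding n_def by linarith+
  then have "x + of_int n * (2 * pi) \<in> {- pi..<pi}"
    by (simp add: field_simps)
  then show thesis by (rule that)
qed

text \<open>The factor is \<open>f\<close> composed with \<open>Arg\<close>, which jumps at the
  negative real axis, so composition gives no continuity there. Instead preimages of closed sets are
  shown closed: each is the image under \<open>cis\<close> of a compact part of
  \<open>{- pi..pi}\<close>.\<close>

lemma continuous_on_circle_factor:
  assumes "f \<in> continuous_circle"
  obtains F where "continuous_on (sphere 0 1) F" "\<And>x. F (cis x) = f x"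
proof -
  have per: "f (x + 2 * pi) = f x" and cont: "continuous_on UNIV f" for x
    using assms by (auto simp: continuous_circle_def)
  have eq: "f x = f y" if "cis x = cis y" for x y
  proof -
    have "exp (\<i> * of_real x) = exp (\<i> * of_real y)" using that by (simp add: cis_conv_exp)
    then obtain n :: int where n: "\<i> * of_real x = \<i> * of_real y + of_int (2 * n) * pi * \<i>"
      unfolding exp_eq by blast
    have "x = y + of_int n * (2 * pi)"
      using arg_cong[where f = Im, OF n] by simp
    then show ?thesis using periodic_int[of f y n] per by simp
  qed
  define F where "F z = f (Arg z)" for z
  have F: "F (cis x) = f x" for x
    unfolding F_def by (rule eq) (simp add: cis_Arg sgn_eq)
  have "closed (F -` C \<inter> sphere 0 1)" if "closed C" for C
  proof -
    have "F -` C \<inter> sphere 0 1 = cis ` ({- pi..pi} \<inter> f -` C)"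
    proof (intro equalityI subsetI)
      fix z assume z: "z \<in> F -` C \<inter> sphere 0 1"
      then have "z \<noteq> 0" "sgn z = z" by (auto simp: sgn_eq)
      then have "z = cis (Arg z)" by (simp add: cis_Arg)
      moreover have "Arg z \<in> {- pi..pi} \<inter> f -` C"
        using z Arg_bounded[of z] by (auto simp: F_def)
      ultimately show "z \<in> cis ` ({- pi..pi} \<inter> f -` C)" by blast
    qed (auto simp: F)
    moreover have "closed ({- pi..pi} \<inter> f -` C)"
      using continuous_closed_vimage[OF that] cont
      by (intro closed_Int) (auto simp: continuous_on_eq_continuous_at)
    then have "compact ({- pi..pi} \<inter> f -` C)"
      by (metis compact_Icc compact_Int_closed inf.left_idem)
    then have "closed (cis ` ({- pi..pi} \<inter> f -` C))"
      by (intro compact_imp_closed compact_continuous_image continuous_intros)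
    ultimately show ?thesis by simp
  qed
  then have "continuous_on (sphere 0 1) F"
    by (subst continuous_on_closed_vimage) auto
  then show thesis using F that by blast
qed


lemma trig_sum_dense:
  assumes "f \<in> continuous_circle" "e > 0"
  obtains d c where "\<And>x. norm (f x - trig_sum d c x) < e"
proof -
  obtain F where F: "continuous_on (sphere 0 1) F" "\<And>x. F (cis x) = f x"
    using continuous_on_circle_factor[OF assms(1)] by blast
  obtain g where g: "polynomial_function g" "\<And>z. z \<in> sphere 0 1 \<Longrightarrow> norm (F z - g z) < e"
    using Stone_Weierstrass_polynomial_function[OF _ F(1) assms(2)] by auto
  have "real_polynomial_function (Re \<circ> g)" "real_polynomial_function (Im \<circ> g)"
    using g(1) bounded_linear_Re bounded_linear_Im unfolding polynomial_function_def by blast+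
  then have "trig_polynomial (\<lambda>x. of_real ((Re \<circ> g) (cis x)) + \<i> * of_real ((Im \<circ> g) (cis x)))"
    by (intro trig_polynomial.add trig_polynomial_mult trig_polynomial_const real_polynomial_function_cis)
  moreover have "(\<lambda>x. of_real ((Re \<circ> g) (cis x)) + \<i> * of_real ((Im \<circ> g) (cis x))) = (\<lambda>x. g (cis x))"
    by (auto simp: complex_eq_iff)
  ultimately obtain d c where "(\<lambda>x. g (cis x)) = trig_sum d c"
    using trig_polynomial_eq_trig_sum by metis
  then have "g (cis x) = trig_sum d c x" for x by (rule fun_cong)
  then have "norm (f x - trig_sum d c x) < e" for x
    using g(2)[of "cis x"] F(2)[of x] by simp
  then show thesis by (rule that)
qed

section \<open>Stability under uniform approximation and the final limit\<close>

lemma continuous_circle_bounded: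
  assumes "f \<in> continuous_circle"
  obtains M where "\<And>x. norm (f x) \<le> M"
proof -
  have per: "\<And>x. f (x + 2 * pi) = f x" and cont: "continuous_on UNIV f"
    using assms by (auto simp: continuous_circle_def)
  have "compact (f ` {- pi..pi})"
    using cont by (intro compact_continuous_image) (auto intro: continuous_on_subset)
  then obtain M where M: "\<forall>y\<in>f ` {- pi..pi}. norm y \<le> M"
    using compact_imp_bounded bounded_iff by metis
  have "norm (f x) \<le> M" for x
  proof -
    obtain n :: int where "x + of_int n * (2 * pi) \<in> {- pi..<pi}" by (rule periodic_representative)
    then have "norm (f (x + of_int n * (2 * pi))) \<le> M" using M by auto
    then show ?thesis by (simp add: periodic_int[of f, OF per])
  qed
  then show thesis by (rule that)
qed

lemma norm_central_difference_le:
  assumes "\<And>x. norm (f x) \<le> M"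
  shows "norm (central_difference r h f x) \<le> 2 ^ r * M"
proof -
  have "norm (central_difference r h f x) \<le> (\<Sum>i = 0..r. real (r choose i) * M)"
    unfolding central_difference_def
    by (intro sum_norm_le) (auto simp: norm_mult norm_power intro!: mult_left_mono assms)
  also have "\<dots> = 2 ^ r * M"
    by (simp add: choose_row_sum atLeast0AtMost flip: sum_distrib_right of_nat_sum)
  finally show ?thesis .
qed

lemma central_difference_diff:
  "central_difference r h (\<lambda>x. f x - g x) x = central_difference r h f x - central_difference r h g x"
  by (simp add: central_difference_def right_diff_distrib sum_subtractf)

text \<open>Periodicity moves an arbitrary \<open>x\<close> into the interval over which the modulus
  is taken; boundedness of \<open>f\<close> makes the real supremum a genuine upper bound.\<close>

lemma norm_central_difference_le_modulus:
  assumes "f \<in> continuous_circle" "\<bar>h\<bar> < \<delta>"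
  shows "norm (central_difference r h f x) \<le> modulus_of_smoothness r f \<delta>"
proof -
  have per: "\<And>x. f (x + 2 * pi) = f x"
    using assms by (auto simp: continuous_circle_def)
  obtain M where M: "\<And>x. norm (f x) \<le> M"
    using continuous_circle_bounded[OF assms(1)] by blast
  obtain n :: int where n: "x + of_int n * (2 * pi) \<in> {- pi..<pi}" by (rule periodic_representative)
  define y where "y = x + of_int n * (2 * pi)"
  have "f (y - real r / 2 * h + real i * h) = f (x - real r / 2 * h + real i * h)" for i
    using periodic_int[of f, OF per, of "x - real r / 2 * h + real i * h" n] by (simp add: y_def algebra_simps)
  then have "central_difference r h f x = central_difference r h f y"
    by (simp add: central_difference_def)
  moreover have "norm (case (y, h) of (x, h) \<Rightarrow> central_difference r h f x) \<le> modulus_of_smoothness r f \<delta>"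
    unfolding modulus_of_smoothness_def case_prod_beta
  proof (rule cSUP_upper)
    show "(y, h) \<in> {- pi..<pi} \<times> {h. \<bar>h\<bar> < \<delta>}" using n assms(2) by (simp add: y_def)
    show "bdd_above ((\<lambda>p. cmod (central_difference r (snd p) f (fst p))) ` ({- pi..<pi} \<times> {h. \<bar>h\<bar> < \<delta>}))"
      by (rule bdd_aboveI2) (rule norm_central_difference_le[OF M])
  qed
  ultimately show ?thesis by simp
qed

lemma fourier_integrand_continuous:
  assumes "continuous_on UNIV f"
  shows "continuous_on S (\<lambda>t. f t * exp (- \<i> * of_int j * complex_of_real t))"
  by (intro continuous_intros continuous_on_subset[OF assms]) auto

lemma fourier_coeff_diff:
  assumes "continuous_on UNIV f" "continuous_on UNIV g"
  shows "fourier_coeff (\<lambda>x. f x - g x) j = fourier_coeff f j - fourier_coeff g j"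
  unfolding fourier_coeff_def left_diff_distrib
  by (subst integral_diff[OF integrable_continuous_interval integrable_continuous_interval,
        OF fourier_integrand_continuous[OF assms(1)] fourier_integrand_continuous[OF assms(2)]])
     (rule right_diff_distrib)

lemma norm_fourier_coeff_le:
  assumes "continuous_on UNIV f" "\<And>x. norm (f x) \<le> M"
  shows "norm (fourier_coeff f j) \<le> M"
proof -
  have "norm (integral {- pi..pi} (\<lambda>t. f t * exp (- \<i> * of_int j * complex_of_real t))) \<le> M * (pi - - pi)"
    by (rule integral_bound[OF _ fourier_integrand_continuous[OF assms(1)]])
       (simp_all add: norm_mult assms(2))
  then show ?thesis
    by (simp add: fourier_coeff_def norm_mult norm_divide field_simps)
qed

lemma vallee_poussin_mean_diff:
  assumes "continuous_on UNIV f" "continuous_on UNIV g"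
  shows "vallee_poussin_mean k m (\<lambda>x. f x - g x) x = vallee_poussin_mean k m f x - vallee_poussin_mean k m g x"
  by (simp add: vallee_poussin_mean_def fourier_partial_sum_def fourier_coeff_diff[OF assms]
      left_diff_distrib right_diff_distrib sum_subtractf diff_divide_distrib)

text \<open>A crude bound, growing with \<open>k\<close> and \<open>m\<close>, for general
  continuous functions. It serves only as a constant multiplying the approximation error, which
  tends to 0.\<close>

lemma norm_vallee_poussin_mean_le:
  assumes "continuous_on UNIV f" "\<And>x. norm (f x) \<le> M"
  shows "norm (vallee_poussin_mean k m f x) \<le> (\<Sum>i = k * m..<(k + 1) * m. 2 * real i + 1) / real m * M"
proof -
  have "norm (fourier_partial_sum i f x) \<le> (2 * real i + 1) * M" for i
  proof -
    have "norm (fourier_partial_sum i f x) \<le> (\<Sum>j = - int i..int i. M)"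
      unfolding fourier_partial_sum_def
      by (intro sum_norm_le) (auto simp: norm_mult intro!: norm_fourier_coeff_le assms)
    then show ?thesis by simp
  qed
  then have "norm (\<Sum>i = k * m..<(k + 1) * m. fourier_partial_sum i f x) \<le>
      (\<Sum>i = k * m..<(k + 1) * m. (2 * real i + 1) * M)"
    by (intro sum_norm_le)
  then show ?thesis
    unfolding sum_distrib_right[symmetric] vallee_poussin_mean_def
    by (simp add: norm_mult norm_divide divide_right_mono)
qed

lemma continuous_on_trig_sum: "continuous_on S (trig_sum d c)"
  unfolding trig_sum_def[abs_def] by (intro continuous_intros)

text \<open>Since the square of \<open>\<alpha>_const\<close> is 3 pi^2/32, four pi^2 times it is
  exactly the threshold of \<open>contraction_constant\<close>.\<close>

lemma alpha_const_step:
  assumes "n > 0"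
  shows "(2 * pi / n * \<alpha>_const * n)\<^sup>2 = 3 * pi ^ 4 / 8"
proof -
  have "(2 powr (- 5 / 2))\<^sup>2 = (2::real) powr (- 5)"
    by (simp add: power2_eq_square flip: powr_add)
  also have "\<dots> = 1 / 32"
    using powr_minus_divide[of "2 :: real" 5] by simp
  finally have 1: "(2 powr (- 5 / 2))\<^sup>2 = (1 / 32 :: real)" .
  have 2: "(3 powr (1 / 2))\<^sup>2 = (3::real)"
    by (simp add: powr_half_sqrt)
  have "2 * pi / n * \<alpha>_const * n = 2 * pi * \<alpha>_const" using assms by simp
  then have "(2 * pi / n * \<alpha>_const * n)\<^sup>2 = 4 * pi\<^sup>2 * ((2 powr (- 5 / 2))\<^sup>2 * (3 powr (1 / 2))\<^sup>2 * pi\<^sup>2)"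
    by (simp add: \<alpha>_const_def power_mult_distrib)
  also have "\<dots> = 3 * pi ^ 4 / 8" unfolding 1 2 by (simp flip: power_add)
  finally show ?thesis .
qed

theorem theorem3:
  fixes k m :: nat and f :: "real \<Rightarrow> complex"
  assumes "k \<ge> 1" and "m \<ge> 2" and "f \<in> continuous_circle"
  shows "circle_norm (\<lambda>x. f x - vallee_poussin_mean k m f x)
           \<le> 2 * (real k + 1)^2 / real ((2 * k) choose k) *
             modulus_of_smoothness (2 * k) f (2 * pi / (real k * real m) * \<alpha>_const)"
proof -
  define h where "h = 2 * pi / (real k * real m) * \<alpha>_const"
  define \<omega> where "\<omega> = modulus_of_smoothness (2 * k) f h"
  define A where "A = 2 * (real k + 1)\<^sup>2 / real ((2 * k) choose k)"
  define K where "K = (\<Sum>i = k * m..<(k + 1) * m. 2 * real i + 1) / real m"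
  \<comment> \<open>\<open>D\<close> collects the costs of replacing \<open>f\<close> by an
    \<open>e\<close>-close trigonometric sum: in the 2k-th difference, in the function itself and in
    the mean. It does not depend on \<open>e\<close>, so choosing the error \<open>e / D\<close>
    lets it vanish.\<close>
  define D where "D = A * 2 ^ (2 * k) + 1 + K"
  have "0 \<le> A" "0 \<le> K" by (auto simp: A_def K_def intro!: divide_nonneg_nonneg sum_nonneg)
  then have "0 < D" by (simp add: D_def add_nonneg_pos add_pos_nonneg)
  have "h > 0" using assms(1,2) by (simp add: h_def \<alpha>_const_def)
  have hn: "3 * pi ^ 4 / 8 \<le> (h * real (k * m))\<^sup>2"
    using alpha_const_step[of "real k * real m"] assms(1,2) by (simp add: h_def)
  have contf: "continuous_on UNIV f" using assms(3) by (simp add: continuous_circle_def)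
  have approx: "norm (f x - vallee_poussin_mean k m f x) \<le> A * \<omega> + D * e" if "e > 0" for x e
  proof -
    obtain d c where p: "\<And>x. norm (f x - trig_sum d c x) < e"
      using trig_sum_dense[OF assms(3) \<open>e > 0\<close>] by blast
    let ?p = "trig_sum d c"
    have "norm (central_difference (2 * k) t ?p y) \<le> \<omega> + 2 ^ (2 * k) * e" if "\<bar>t\<bar> < h" for t y
    proof -
      have "norm (central_difference (2 * k) t f y - central_difference (2 * k) t ?p y) \<le> 2 ^ (2 * k) * e"
        unfolding central_difference_diff[symmetric]
        by (rule norm_central_difference_le) (rule less_imp_le[OF p])
      moreover have "norm (central_difference (2 * k) t f y) \<le> \<omega>"
        unfolding \<omega>_def by (rule norm_central_difference_le_modulus[OF assms(3) that])
      ultimately show ?thesis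
        using norm_triangle_sub[of "central_difference (2 * k) t ?p y" "central_difference (2 * k) t f y"]
        by (simp add: norm_minus_commute)
    qed
    from trig_sum_approximation[OF assms(1) _ \<open>h > 0\<close> hn this, of x]
    have 1: "norm (?p x - vallee_poussin_mean k m ?p x) \<le> A * (\<omega> + 2 ^ (2 * k) * e)"
      using assms(2) by (simp add: A_def)
    have 2: "norm (vallee_poussin_mean k m f x - vallee_poussin_mean k m ?p x) \<le> K * e"
      unfolding vallee_poussin_mean_diff[OF contf continuous_on_trig_sum, symmetric] K_def
      by (rule norm_vallee_poussin_mean_le)
         (auto intro!: continuous_on_diff contf continuous_on_trig_sum less_imp_le[OF p])
    have "f x - vallee_poussin_mean k m f x = (?p x - vallee_poussin_mean k m ?p x) + (f x - ?p x)
        - (vallee_poussin_mean k m f x - vallee_poussin_mean k m ?p x)" by simp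
    also have "norm \<dots> \<le> A * (\<omega> + 2 ^ (2 * k) * e) + e + K * e"
      by (intro order_trans[OF norm_triangle_ineq4] order_trans[OF norm_triangle_ineq] add_mono 1 2 less_imp_le[OF p])
    also have "\<dots> = A * \<omega> + D * e" by (simp add: D_def algebra_simps)
    finally show ?thesis .
  qed
  have "norm (f x - vallee_poussin_mean k m f x) \<le> A * \<omega>" for x
  proof (rule field_le_epsilon)
    fix e :: real assume "e > 0"
    then show "norm (f x - vallee_poussin_mean k m f x) \<le> A * \<omega> + e"
      using approx[of "e / D" x] \<open>0 < D\<close> by simp
  qed
  then have "circle_norm (\<lambda>x. f x - vallee_poussin_mean k m f x) \<le> A * \<omega>"
    unfolding circle_norm_def by (intro cSUP_least) auto
  then show ?thesis by (simp only: A_def \<omega>_def h_def)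
qed

end
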